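(* Let $m$ and $s$ be positive integers with $m\geq 2$ and $m\geq s$, and let $r>0$. Let $H: B_{M_m}(0;r)\to M_s$ be a holomorphic function between complex matrix algebras. Assume that $H$ is orthogonally additive and orthogonally multiplicative on self-adjoint elements. Then either (A) the range of $H$ consists of zero trace elements (this case occurs whenever $s<m$), or (B) there exist a complex scalar sequence $\{\lambda_n\}_{n\ge 1}$ (some $\lambda_n$ can be zero) and an invertible $m\times m$ complex matrix $S$ such that $$ H(x) = \sum_{n\geq 1} \lambda_n S^{-1}x^nS, \quad\forall x\in B_{M_m}(0;r),\qquad (\ddag) $$ or $$ H(x) = \sum_{n\geq 1} \lambda_n S^{-1}(x^t)^nS, \quad\forall x\in B_{M_m}(0;r). $$ Moreover, in case (B), $H$ always has a representation of the form $(\ddag)$ when $H$ also preserves zero products, i.e., when $$ ab =0 \ \implies\ H(a)H(b) = 0, \qquad \forall a,b \in B_{M_m}(0;r). $$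
   Context: $M_k$ denotes the C*-algebra of complex $k\times k$ matrices (with the operator norm), and $x^t$ denotes the transpose of the matrix $x$. For a Banach space $E$, $B_E(a;r)$ denotes the open ball in $E$ centered at $a$ with radius $r>0$. For Banach spaces $E,F$ and a positive integer $n$, a map $P:E\to F$ is a bounded $n$-homogeneous polynomial if there is a bounded symmetric $n$-linear operator $T:E\times\cdots\times E\to F$ with $P(x)=T(x,\ldots,x)$ for all $x\in E$; a $0$-homogeneous polynomial is a constant map. A map $H:U\to F$ on a nonempty open set $U\subseteq E$ is holomorphic if for each $a\in U$ there exist an open ball $B_E(a;\rho)\subseteq U$ with $\rho>0$ and a unique sequence of bounded $n$-homogeneous polynomials $P_n:E\to F$ ($n\ge 0$) such that $H(x)=\sum_{n=0}^\infty P_n(x-a)$ uniformly for $x\in B_E(a;\rho)$. A map $H$ between complex matrices is orthogonally additive on self-adjoint elements if $H(a+b)=H(a)+H(b)$ whenever $a,b$ are self-adjoint complex matrices in its domain with $ab=0$; it is orthogonally multiplicative on self-adjoint elements if $H(a)H(b)=0$ whenever $a,b$ are self-adjoint complex matrices in its domain with $ab=0$. *)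

theory Defs
  imports "HOL-Analysis.Analysis" "HOL-Library.Multiset"
begin

text \<open>
  The matrix algebra \<open>M\<^sub>k\<close> is the type \<open>complex^'k^'k\<close> with \<open>CARD('k) = k\<close>.  Its product is \<open>**\<close>
  and its unit is \<open>mat 1\<close>; the library's \<open>*\<close>, \<open>1\<close>, \<open>^\<close> on this type act entrywise and
  are not used.  The library's \<open>norm\<close> on this type is the Frobenius norm, so the C*-norm is
  introduced separately.  The two norms are equivalent, hence topological notions (\<open>sums\<close>,
  limits) may be taken from the library.
\<close>

type_synonym 'k cmat = "complex^'k^'k"

definition op_norm :: "'k::finite cmat \<Rightarrow> real" where
  "op_norm A = onorm (\<lambda>v. A *v v)"

definition op_ball :: "'k::finite cmat \<Rightarrow> real \<Rightarrow> 'k cmat set" where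
  "op_ball A r = {X. op_norm (X - A) < r}"

definition cscale :: "complex \<Rightarrow> 'k::finite cmat \<Rightarrow> 'k cmat" where
  "cscale c A = (\<chi> i j. c * A $ i $ j)"

primrec mpow :: "'k::finite cmat \<Rightarrow> nat \<Rightarrow> 'k cmat" where
  "mpow A 0 = mat 1"
| "mpow A (Suc n) = A ** mpow A n"

definition self_adjoint :: "'k::finite cmat \<Rightarrow> bool" where
  "self_adjoint A \<longleftrightarrow> (\<chi> i j. cnj (A $ j $ i)) = A"

text \<open>
  An \<open>n\<close>-linear operator is a function on lists, of which only the values on lists of
  length \<open>n\<close> matter.
\<close>

definition bounded_symmetric_multilinear ::
    "nat \<Rightarrow> ('m::finite cmat list \<Rightarrow> 's::finite cmat) \<Rightarrow> bool" where
  "bounded_symmetric_multilinear n T \<longleftrightarrow>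
     (\<forall>xs i a b. length xs = n \<longrightarrow> i < n \<longrightarrow>
        T (xs[i := a + b]) = T (xs[i := a]) + T (xs[i := b])) \<and>
     (\<forall>xs i c a. length xs = n \<longrightarrow> i < n \<longrightarrow>
        T (xs[i := cscale c a]) = cscale c (T (xs[i := a]))) \<and>
     (\<forall>xs ys. length xs = n \<longrightarrow> mset ys = mset xs \<longrightarrow> T ys = T xs) \<and>
     (\<exists>K. \<forall>xs. length xs = n \<longrightarrow> op_norm (T xs) \<le> K * prod_list (map op_norm xs))"

text \<open>For \<open>n = 0\<close> the following says precisely that \<open>P\<close> is constant, with value \<open>T []\<close>.\<close>

definition bounded_homogeneous_polynomial ::
    "nat \<Rightarrow> ('m::finite cmat \<Rightarrow> 's::finite cmat) \<Rightarrow> bool" where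
  "bounded_homogeneous_polynomial n P \<longleftrightarrow>
     (\<exists>T. bounded_symmetric_multilinear n T \<and> (\<forall>x. P x = T (replicate n x)))"

definition mat_holomorphic_on ::
    "('m::finite cmat \<Rightarrow> 's::finite cmat) \<Rightarrow> 'm cmat set \<Rightarrow> bool" where
  "mat_holomorphic_on H U \<longleftrightarrow>
     (\<forall>a\<in>U. \<exists>\<rho>>0. op_ball a \<rho> \<subseteq> U \<and>
        (\<exists>!P. (\<forall>n. bounded_homogeneous_polynomial n (P n)) \<and>
              uniform_limit (op_ball a \<rho>) (\<lambda>N x. \<Sum>n<N. P n (x - a)) H sequentially))"

text \<open>
  For self-adjoint \<open>a\<close>, \<open>b\<close> with \<open>a ** b = 0\<close> the operator norm of \<open>a + b\<close> is the maximum of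
  those of \<open>a\<close> and \<open>b\<close>, so on a ball \<open>D\<close> about 0 the sum lies in \<open>D\<close> automatically.
\<close>

definition orthogonally_additive_sa ::
    "'m::finite cmat set \<Rightarrow> ('m cmat \<Rightarrow> 's::finite cmat) \<Rightarrow> bool" where
  "orthogonally_additive_sa D H \<longleftrightarrow>
     (\<forall>a\<in>D. \<forall>b\<in>D. self_adjoint a \<longrightarrow> self_adjoint b \<longrightarrow> a ** b = 0 \<longrightarrow> H (a + b) = H a + H b)"

definition orthogonally_multiplicative_sa ::
    "'m::finite cmat set \<Rightarrow> ('m cmat \<Rightarrow> 's::finite cmat) \<Rightarrow> bool" where
  "orthogonally_multiplicative_sa D H \<longleftrightarrow>
     (\<forall>a\<in>D. \<forall>b\<in>D. self_adjoint a \<longrightarrow> self_adjoint b \<longrightarrow> a ** b = 0 \<longrightarrow> H a ** H b = 0)"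

definition preserves_zero_products ::
    "'m::finite cmat set \<Rightarrow> ('m cmat \<Rightarrow> 's::finite cmat) \<Rightarrow> bool" where
  "preserves_zero_products D H \<longleftrightarrow>
     (\<forall>a\<in>D. \<forall>b\<in>D. a ** b = 0 \<longrightarrow> H a ** H b = 0)"

text \<open>
  \<open>conj_series \<lambda> S y\<close> is the sequence of terms \<open>\<lambda>\<^sub>n S\<^sup>-\<^sup>1 y\<^sup>n S\<close>, \<open>n \<ge> 1\<close>, indexed from 0.
  The codomain \<open>M\<^sub>s\<close> and the domain \<open>M\<^sub>m\<close> have different index types even when \<open>s = m\<close>, so the
  \<open>m \<times> m\<close> matrix \<open>S\<close> has its rows indexed by \<open>'m\<close> and its columns by \<open>'s\<close>.  The
  library's \<open>invertible\<close> requires a two-sided inverse, so it forces \<open>CARD('s) = CARD('m)\<close>.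
\<close>

definition conj_series ::
    "(nat \<Rightarrow> complex) \<Rightarrow> complex^'s^'m \<Rightarrow> 'm::finite cmat \<Rightarrow> nat \<Rightarrow> 's::finite cmat" where
  "conj_series lam S y =
     (\<lambda>n. cscale (lam (Suc n)) (matrix_inv S ** mpow y (Suc n) ** S))"

end

theory Submission
  imports Defs "HOL-Complex_Analysis.Cauchy_Integral_Formula"
begin

text \<open>
  The \<open>n\<close>-th Taylor polynomial \<open>P\<^sub>n\<close> of \<open>H\<close> at \<open>0\<close> inherits orthogonal additivity, so by the
  spectral theorem \<open>P\<^sub>n(x) = \<Phi>\<^sub>n(x\<^sup>n)\<close> for a linear map \<open>\<Phi>\<^sub>n\<close>, first for self-adjoint \<open>x\<close> and then
  for all \<open>x\<close> by polynomial continuation along \<open>a + tb\<close>.  Orthogonal multiplicativity gives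
  \<open>\<Phi>\<^sub>j(p) \<Phi>\<^sub>k(q) = 0\<close> for orthogonal projections \<open>p\<close>, \<open>q\<close>; hence \<open>h = \<Phi>\<^sub>j(1)\<close> commutes with the values
  of \<open>\<Phi>\<^sub>j\<close> and \<open>\<Phi>\<^sub>j(x)\<^sup>2 = h \<Phi>\<^sub>j(x\<^sup>2)\<close>.  If some \<open>\<Phi>\<^sub>j\<close> takes a value of non-zero trace, then no
  \<open>\<Phi>\<^sub>j(E\<^sub>i\<^sub>i)\<^sup>3\<close> vanishes, which yields \<open>m\<close> independent vectors in \<open>\<complex>\<^sup>s\<close>.  Then \<open>s = m\<close>, \<open>h\<close> is invertible
  and, up to conjugation, \<open>h\<^sup>-\<^sup>1 \<Phi>\<^sub>j\<close> is a Jordan homomorphism fixing the \<open>E\<^sub>i\<^sub>i\<close>: a diagonal conjugation,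
  possibly composed with the transpose.  All other \<open>\<Phi>\<^sub>k\<close> are scalar multiples of it.
\<close>

section \<open>The matrix algebra\<close>

lemma cscale_nth [simp]: "cscale c A $ i $ j = c * A $ i $ j"
  by (simp add: cscale_def)

lemma cmat_eq_iff: "A = B \<longleftrightarrow> (\<forall>i j. A $ i $ j = B $ i $ j)"
  by (simp add: vec_eq_iff)

lemma cscale_add_right: "cscale c (A + B) = cscale c A + cscale c B"
  and cscale_diff_right: "cscale c (A - B) = cscale c A - cscale c B"
  and cscale_add_left: "cscale (c + d) A = cscale c A + cscale d A"
  and cscale_cscale [simp]: "cscale c (cscale d A) = cscale (c * d) A"
  and cscale_1 [simp]: "cscale 1 A = A"
  and cscale_0_left [simp]: "cscale 0 A = 0"
  and cscale_0_right [simp]: "cscale c 0 = 0"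
  by (simp_all add: cmat_eq_iff algebra_simps)

lemma cscale_sum: "cscale c (\<Sum>i\<in>I. f i) = (\<Sum>i\<in>I. cscale c (f i))"
  by (simp add: cmat_eq_iff sum_distrib_left)

lemma cscale_eq_0_iff [simp]: "cscale c A = 0 \<longleftrightarrow> c = 0 \<or> A = 0"
  by (auto simp: cmat_eq_iff)

lemma mult_nth: "(A ** B) $ i $ j = (\<Sum>k\<in>UNIV. A $ i $ k * B $ k $ j)"
  by (simp add: matrix_matrix_mult_def)

lemma cscale_mult_left [simp]:
  fixes A :: "'k::finite cmat" shows "cscale c A ** B = cscale c (A ** B)"
  by (simp add: cmat_eq_iff mult_nth sum_distrib_left mult.assoc)

lemma cscale_mult_right [simp]:
  fixes A :: "'k::finite cmat" shows "A ** cscale c B = cscale c (A ** B)"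
  by (simp add: cmat_eq_iff mult_nth sum_distrib_left ac_simps)

lemma matrix_diff_ldistrib: "A ** (B - C) = A ** B - A ** (C :: complex^'p^'n)"
  by (simp add: cmat_eq_iff mult_nth algebra_simps sum_subtractf)

lemma matrix_diff_rdistrib: "(A - B) ** C = A ** C - B ** (C :: complex^'p^'n)"
  by (simp add: cmat_eq_iff mult_nth algebra_simps sum_subtractf)

lemma matrix_add_rdistrib: "(A + B) ** C = A ** C + B ** (C :: complex^'p^'n)"
  by (simp add: cmat_eq_iff mult_nth algebra_simps sum.distrib)

lemma matrix_sum_ldistrib: "A ** (\<Sum>i\<in>I. f i) = (\<Sum>i\<in>I. A ** (f i :: complex^'p^'n))"
  by (induction I rule: infinite_finite_induct) (auto simp: matrix_add_ldistrib)

lemma matrix_sum_rdistrib: "(\<Sum>i\<in>I. f i) ** C = (\<Sum>i\<in>I. f i ** (C :: complex^'p^'n))"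
  by (induction I rule: infinite_finite_induct) (auto simp: matrix_add_rdistrib)

lemma mpow_commute:
  assumes "A ** B = B ** A"
  shows "mpow A n ** B = B ** mpow A n"
proof (induction n)
  case (Suc n)
  then show ?case by (metis assms matrix_mul_assoc mpow.simps(2))
qed simp

lemma mpow_add: "mpow A (m + n) = mpow A m ** mpow A n"
  by (induction m) (simp_all add: matrix_mul_assoc)

lemma mpow_Suc_right: "mpow A (Suc n) = mpow A n ** A"
  by (simp add: mpow_commute)

lemma mpow_cscale: "mpow (cscale c A) n = cscale (c ^ n) (mpow A n)"
  by (induction n) (simp_all add: mult.commute)

lemma mpow_mult_commute:
  assumes "A ** B = B ** A"
  shows "mpow (A ** B) n = mpow A n ** mpow B n"
proof (induction n)
  case (Suc n)
  have "mpow A n ** B = B ** mpow A n"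
    by (rule mpow_commute) fact
  then show ?case
    using Suc by (metis matrix_mul_assoc mpow.simps(2))
qed simp

lemma mpow_mult: "mpow A (m * n) = mpow (mpow A m) n"
  by (induction n) (simp_all add: mpow_add)

lemma transpose_mpow: "transpose (mpow A n) = mpow (transpose A) n"
  by (induction n) (simp_all add: matrix_transpose_mul mpow_commute transpose_mat)


section \<open>The spectral theorem\<close>

definition adjoint_matrix :: "'k::finite cmat \<Rightarrow> 'k cmat" where
  "adjoint_matrix A = (\<chi> i j. cnj (A $ j $ i))"

lemma self_adjoint_iff: "self_adjoint A \<longleftrightarrow> adjoint_matrix A = A"
  by (simp add: self_adjoint_def adjoint_matrix_def)

lemma self_adjointD: "self_adjoint A \<Longrightarrow> adjoint_matrix A = A"
  by (simp add: self_adjoint_iff)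

lemma adjoint_matrix_nth [simp]: "adjoint_matrix A $ i $ j = cnj (A $ j $ i)"
  by (simp add: adjoint_matrix_def)

lemma adjoint_matrix_add [simp]: "adjoint_matrix (A + B) = adjoint_matrix A + adjoint_matrix B"
  and adjoint_matrix_diff [simp]: "adjoint_matrix (A - B) = adjoint_matrix A - adjoint_matrix B"
  and adjoint_matrix_cscale [simp]: "adjoint_matrix (cscale c A) = cscale (cnj c) (adjoint_matrix A)"
  and adjoint_matrix_0 [simp]: "adjoint_matrix 0 = 0"
  by (simp_all add: cmat_eq_iff)

lemma adjoint_matrix_mult: "adjoint_matrix (A ** B) = adjoint_matrix B ** adjoint_matrix A"
  by (simp add: cmat_eq_iff mult_nth mult.commute)

lemma adjoint_matrix_mat_1 [simp]: "adjoint_matrix (mat 1) = mat 1"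
  by (simp add: cmat_eq_iff mat_def)

lemma self_adjoint_sum: "(\<And>i. i \<in> I \<Longrightarrow> self_adjoint (f i)) \<Longrightarrow> self_adjoint (\<Sum>i\<in>I. f i)"
  by (induction I rule: infinite_finite_induct) (auto simp: self_adjoint_iff)

lemma self_adjoint_cscale_of_real: "self_adjoint A \<Longrightarrow> self_adjoint (cscale (of_real t) A)"
  by (simp add: self_adjoint_iff)

lemma inner_complex_mult: "inner (a * x) y = inner x (cnj a * (y::complex))"
  by (simp add: inner_complex_def algebra_simps)

text \<open>\<open>inner\<close> is the real inner product of the complex coordinate space, the real
  part of the Hermitian one. Symmetry with respect to it suffices for the variational argument
  below.\<close>

lemma self_adjoint_inner:
  fixes A :: "'k::finite cmat"
  assumes "self_adjoint A"
  shows "inner (A *v x) y = inner x (A *v y)"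
proof -
  have A: "cnj (A $ i $ j) = A $ j $ i" for i j
    by (metis adjoint_matrix_nth assms self_adjointD)
  have "inner (A *v x) y = (\<Sum>i\<in>UNIV. \<Sum>j\<in>UNIV. inner (x $ j) (A $ j $ i * y $ i))"
    by (simp add: inner_vec_def matrix_vector_mult_def inner_sum_left inner_complex_mult A)
  also have "\<dots> = inner x (A *v y)"
    by (subst sum.swap) (simp add: inner_vec_def matrix_vector_mult_def inner_sum_right)
  finally show ?thesis .
qed

lemma matrix_vector_mult_scaleR_complex:
  fixes A :: "complex^'n^'m"
  shows "A *v (c *\<^sub>R x) = c *\<^sub>R (A *v x)"
  using linear_iff matrix_vector_mul_linear by blast

text \<open>A unit vector maximising the quadratic form of \<open>A\<close> on the range of \<open>Q\<close> is an eigenvector.\<close>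

lemma self_adjoint_eigenvector:
  fixes A Q :: "'k::finite cmat"
  assumes A: "self_adjoint A" and QQ: "Q ** Q = Q" and AQ: "A ** Q = Q ** A" and Q0: "Q \<noteq> 0"
  obtains v t where "norm v = 1" "Q *v v = v" "A *v v = t *\<^sub>R v"
proof -
  define K where "K = sphere 0 1 \<inter> {v. Q *v v = v}"
  define f where "f = (\<lambda>v. inner (A *v v) v)"
  have "compact K"
    unfolding K_def
    by (intro compact_Int_closed closed_Collect_eq continuous_intros) auto
  obtain w where w: "Q *v w \<noteq> 0"
    using Q0 matrix_eq[of Q 0] by auto
  have "(1 / norm (Q *v w)) *\<^sub>R (Q *v w) \<in> K"
    using w by (simp add: K_def matrix_vector_mult_scaleR_complex matrix_vector_mul_assoc QQ)
  then have "K \<noteq> {}" by blast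
  moreover have "continuous_on K f"
    unfolding f_def by (intro continuous_intros)
  ultimately obtain v where v: "v \<in> K" and max: "\<And>u. u \<in> K \<Longrightarrow> f u \<le> f v"
    using continuous_attains_sup[OF \<open>compact K\<close>] by blast
  have nv: "norm v = 1" and Qv: "Q *v v = v"
    using v by (auto simp: K_def)
  define M where "M = f v"
  have le: "f u \<le> M * inner u u" if "Q *v u = u" for u
  proof (cases "u = 0")
    case False
    then have "(1 / norm u) *\<^sub>R u \<in> K"
      using that by (simp add: K_def matrix_vector_mult_scaleR_complex)
    from max[OF this] have "f u / (norm u)^2 \<le> M"
      by (simp add: f_def M_def matrix_vector_mult_scaleR_complex power2_eq_square)
    then show ?thesis
      using False by (simp add: divide_le_eq dot_square_norm)
  qed (simp add: f_def)
  define w where "w = A *v v - M *\<^sub>R v"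
  have Qw: "Q *v w = w"
    by (metis AQ Qv matrix_vector_mul_assoc matrix_vector_mult_diff_distrib
        matrix_vector_mult_scaleR_complex w_def)
  have Av: "A *v v = w + M *\<^sub>R v"
    by (simp add: w_def)
  have "inner (A *v v) v = M"
    by (simp add: M_def f_def)
  moreover have vv: "inner v v = 1"
    using nv by (simp add: dot_square_norm)
  ultimately have wv: "inner w v = 0"
    by (simp add: w_def inner_diff_left)
  have "w = 0"
  proof (rule ccontr)
    assume "w \<noteq> 0"
    define C where "C = M * inner w w - inner (A *v w) w"
    have ww: "inner w w > 0" using \<open>w \<noteq> 0\<close> by simp
    \<comment> \<open>The maximum is tested on v + t w, where w is the residual of v. The
      first-order gain 2t<w,w> is bounded by a term quadratic in t, which fails for small positive t
      unless w = 0.\<close>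
    have key: "2 * t * inner w w \<le> t^2 * C" for t
    proof -
      have "Q *v (v + t *\<^sub>R w) = v + t *\<^sub>R w"
        by (simp add: Qv Qw matrix_vector_mult_scaleR_complex matrix_vector_right_distrib)
      from le[OF this]
      have "inner (A *v v) v + t * inner (A *v v) w + t * inner (A *v w) v + t^2 * inner (A *v w) w
          \<le> M * (inner v v + 2 * t * inner w v + t^2 * inner w w)"
        by (simp add: f_def matrix_vector_right_distrib matrix_vector_mult_scaleR_complex
            inner_add_left inner_add_right inner_commute algebra_simps power2_eq_square)
      moreover have "inner (A *v w) v = inner (A *v v) w"
        by (metis inner_commute self_adjoint_inner[OF A])
      moreover have "inner (A *v v) w = inner w w"
        using wv by (simp add: Av inner_add_left inner_add_right inner_commute)
      ultimately show ?thesis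
        using \<open>inner (A *v v) v = M\<close> vv wv by (simp add: C_def algebra_simps)
    qed
    define t where "t = inner w w / (\<bar>C\<bar> + 1)"
    have "t > 0" using ww by (simp add: t_def)
    have "t * (2 * inner w w) \<le> t * (t * C)"
      using key[of t] by (simp add: power2_eq_square algebra_simps)
    then have "2 * inner w w \<le> t * C"
      using \<open>t > 0\<close> by simp
    also have "\<dots> \<le> t * (\<bar>C\<bar> + 1)"
      using \<open>t > 0\<close> by (intro mult_left_mono) auto
    also have "\<dots> = inner w w"
      by (simp add: t_def)
    finally show False using ww by simp
  qed
  then show ?thesis
    using that[OF nv Qv, of M] Av by simp
qed

definition orthogonal_projections :: "nat \<Rightarrow> (nat \<Rightarrow> 'k::finite cmat) \<Rightarrow> bool" where
  "orthogonal_projections N p \<longleftrightarrow> (\<forall>i<N. self_adjoint (p i)) \<and>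
     (\<forall>i<N. \<forall>j<N. p i ** p j = (if i = j then p i else 0))"

text \<open>Restricting to the range of a commuting projection Q makes an induction on its dimension
  possible: once the projection p onto the line of an eigenvector is split off, A and Q - p satisfy
  the same hypotheses on a smaller space.\<close>

lemma spectral_decomposition_of_projection:
  fixes A Q :: "'k::finite cmat"
  assumes A: "self_adjoint A" and "self_adjoint Q" "Q ** Q = Q" "A ** Q = Q ** A"
  shows "\<exists>N p t. orthogonal_projections N p \<and> (\<forall>i<N. A ** p i = cscale (of_real (t i)) (p i)) \<and>
    Q = (\<Sum>i<N. p i)"
  using assms(2-)
proof (induction "dim {v. Q *v v = v}" arbitrary: Q rule: less_induct)
  case less
  note Q = self_adjointD[OF less.prems(1)]
  show ?case
  proof (cases "Q = 0")
    case True
    then have "orthogonal_projections 0 (\<lambda>_. 0 :: 'k cmat) \<and> Q = (\<Sum>i<0::nat. 0)"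
      by (simp add: orthogonal_projections_def)
    then show ?thesis by blast
  next
    case False
    from self_adjoint_eigenvector[OF A less.prems(2,3) this]
    obtain v t where v: "norm v = 1" "Q *v v = v" "A *v v = t *\<^sub>R v" .
    define p where "p = (\<chi> i j. v $ i * cnj (v $ j))"
    have pnth: "p $ i $ j = v $ i * cnj (v $ j)" for i j
      by (simp add: p_def)
    have left: "(B ** p) $ i $ j = (B *v v) $ i * cnj (v $ j)" for B :: "'k cmat" and i j
      by (simp add: mult_nth pnth matrix_vector_mult_def sum_distrib_right mult.assoc)
    have p: "adjoint_matrix p = p"
      by (simp add: cmat_eq_iff pnth)
    have "inner v v = 1"
      using v(1) by (simp add: dot_square_norm)
    then have "(\<Sum>k\<in>UNIV. of_real (inner (v $ k) (v $ k))) = (1 :: complex)"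
      by (simp add: inner_vec_def flip: of_real_sum)
    then have norm_v: "(\<Sum>k\<in>UNIV. cnj (v $ k) * v $ k) = 1"
      by (simp add: dot_square_norm complex_norm_square[symmetric] mult.commute)
    have pv: "p *v v = v"
      by (simp add: vec_eq_iff matrix_vector_mult_def pnth mult.assoc norm_v flip: sum_distrib_left)
    have pp: "p ** p = p"
      by (simp add: cmat_eq_iff left pv) (simp add: pnth)
    have Qp: "Q ** p = p"
      by (simp add: cmat_eq_iff left v) (simp add: pnth)
    have pQ: "p ** Q = p"
      by (metis Q Qp adjoint_matrix_mult p)
    have Ap: "A ** p = cscale (of_real t) p"
      by (simp add: cmat_eq_iff left v) (simp add: pnth scaleR_conv_of_real mult.assoc)
    have pA: "p ** A = cscale (of_real t) p"
      using arg_cong[OF Ap, of adjoint_matrix] by (simp add: adjoint_matrix_mult p self_adjointD[OF A])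
    define R where "R = Q - p"
    have R: "self_adjoint R" "R ** R = R" "A ** R = R ** A"
      by (simp_all add: R_def self_adjoint_iff Q p matrix_diff_ldistrib matrix_diff_rdistrib
          less.prems pp Qp pQ Ap pA)
    have pR: "p ** R = 0"
      by (simp add: R_def matrix_diff_ldistrib pp pQ)
    have "Q ** R = R"
      by (simp add: R_def matrix_diff_ldistrib less.prems Qp)
    have subQ: "subspace {u. B *v u = u}" for B :: "'k cmat"
      by (auto simp: subspace_def matrix_vector_right_distrib matrix_vector_mult_scaleR_complex)
    have "{u. R *v u = u} \<subseteq> {u. Q *v u = u}"
      using \<open>Q ** R = R\<close> by auto (metis matrix_vector_mul_assoc)
    moreover have "v \<notin> {u. R *v u = u}"
      using v(1) by (simp add: R_def matrix_vector_mult_diff_rdistrib v(2) pv) auto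
    ultimately have "{u. R *v u = u} \<subset> {u. Q *v u = u}"
      using v(2) by auto
    then have "dim {u. R *v u = u} < dim {u. Q *v u = u}"
      by (intro dim_psubset) (simp add: subQ span_eq_iff[THEN iffD2])
    from less.hyps[OF this R] obtain N q s
      where q: "orthogonal_projections N q" "\<And>i. i < N \<Longrightarrow> A ** q i = cscale (of_real (s i)) (q i)"
        "R = (\<Sum>i<N. q i)" by blast
    have qq: "\<And>i. i < N \<Longrightarrow> adjoint_matrix (q i) = q i"
      "\<And>i j. i < N \<Longrightarrow> j < N \<Longrightarrow> q i ** q j = (if i = j then q i else 0)"
      using q(1) by (auto simp: orthogonal_projections_def self_adjoint_iff)
    \<comment> \<open>Each \<open>q i\<close> lies below R, that is, \<open>R ** q i = q i\<close>,
      and p annihilates R.\<close>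
    have pq: "p ** q i = 0" if "i < N" for i
    proof -
      have "R ** q i = (\<Sum>j<N. if j = i then q i else 0)"
        unfolding q(3) matrix_sum_rdistrib using that by (intro sum.cong) (auto simp: qq)
      then have "R ** q i = q i" using that by simp
      then show ?thesis by (metis matrix_mul_assoc pR times0_left)
    qed
    have qp: "q i ** p = 0" if "i < N" for i
      using arg_cong[OF pq[OF that], of adjoint_matrix] that by (simp add: adjoint_matrix_mult p qq)
    have "orthogonal_projections (Suc N) (q(N := p))"
      by (auto simp: orthogonal_projections_def less_Suc_eq self_adjoint_iff p pp pq qp qq)
    moreover have "\<forall>i<Suc N. A ** (q(N := p)) i = cscale (of_real ((s(N := t)) i)) ((q(N := p)) i)"
      by (auto simp: less_Suc_eq q(2) Ap)
    moreover have "Q = (\<Sum>i<Suc N. (q(N := p)) i)"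
      using q(3) by (simp add: R_def algebra_simps)
    ultimately show ?thesis by blast
  qed
qed

text \<open>The previous lemma with Q the identity. The eigenvalues \<open>t i\<close> need not be
  distinct.\<close>

theorem spectral_decomposition:
  fixes A :: "'k::finite cmat"
  assumes "self_adjoint A"
  obtains N p t where "orthogonal_projections N p" "(\<Sum>i<N. p i) = mat 1"
    "\<And>n. mpow A n = (\<Sum>i<N. cscale (of_real (t i ^ n)) (p i))"
proof -
  obtain N p t where p: "orthogonal_projections N p" "(\<Sum>i<N. p i) = mat 1"
    and Ap: "\<And>i. i < N \<Longrightarrow> A ** p i = cscale (of_real (t i)) (p i)"
    using spectral_decomposition_of_projection[OF assms, of "mat 1"]
    by (auto simp: self_adjoint_iff)
  have pow: "mpow A n ** p i = cscale (of_real (t i ^ n)) (p i)" if "i < N" for n i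
  proof (induction n)
    case (Suc n)
    then show ?case
      using Ap[OF that] by (simp add: mult.commute flip: matrix_mul_assoc)
  qed simp
  have "mpow A n = (\<Sum>i<N. cscale (of_real (t i ^ n)) (p i))" for n
  proof -
    have "mpow A n = mpow A n ** (\<Sum>i<N. p i)" by (simp add: p)
    also have "\<dots> = (\<Sum>i<N. cscale (of_real (t i ^ n)) (p i))"
      unfolding matrix_sum_ldistrib by (intro sum.cong) (auto simp: pow)
    finally show ?thesis .
  qed
  with p show ?thesis by (rule that)
qed


section \<open>Nilpotent matrices\<close>

text \<open>A linear right inverse of M on its range, written as a matrix, serves as G. It makes
  \<open>mat 1 - G ** M\<close> an idempotent whose range is the kernel of M.\<close>

lemma generalized_inverse_exists:
  fixes M :: "complex^'n^'m"
  obtains G :: "complex^'m^'n" where "M ** G ** M = M"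
proof -
  obtain g where g: "Vector_Spaces.linear (*s) (*s) g" "\<And>v. M *v g (M *v v) = M *v v"
    using vec.linear_exists_right_inverse_on[OF matrix_vector_mul_linear_gen[of M] vec.subspace_UNIV]
    by auto
  have "M ** matrix g ** M = M"
    using g by (simp add: matrix_eq matrix_works flip: matrix_vector_mul_assoc)
  then show ?thesis by (rule that)
qed

text \<open>If \<open>P\<^sub>j\<close> projects onto the kernel of \<open>N\<^sup>j\<close>, then \<open>N P\<^sub>j\<^sub>+\<^sub>1 = P\<^sub>j N P\<^sub>j\<^sub>+\<^sub>1\<close>, so the
  trace of \<open>N P\<^sub>j\<close> does not depend on \<open>j\<close>.\<close>

lemma trace_nilpotent:
  fixes N :: "'k::finite cmat"
  assumes "mpow N k = 0"
  shows "trace N = 0"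
proof -
  have "\<forall>j. \<exists>G. mpow N j ** G ** mpow N j = mpow N j"
    by (meson generalized_inverse_exists)
  then obtain G where G: "\<And>j. mpow N j ** G j ** mpow N j = mpow N j"
    by metis
  define P where "P j = mat 1 - G j ** mpow N j" for j
  have ker: "mpow N j ** P j = 0" for j
    by (simp add: P_def matrix_diff_ldistrib matrix_mul_assoc G)
  have absorb: "P j ** X = X" if "mpow N j ** X = 0" for j X
    using that by (simp add: P_def matrix_diff_rdistrib flip: matrix_mul_assoc)
  have step: "trace (N ** P (Suc j)) = trace (N ** P j)" for j
  proof -
    have "P j ** (N ** P (Suc j)) = N ** P (Suc j)"
      using ker[of "Suc j"] by (intro absorb) (simp add: matrix_mul_assoc mpow_commute)
    moreover have "P (Suc j) ** P j = P j"
      using ker[of j] by (intro absorb) (simp flip: matrix_mul_assoc)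
    ultimately show ?thesis
      by (metis matrix_mul_assoc trace_mul_sym)
  qed
  \<comment> \<open>\<open>P 0\<close> is zero because the zeroth power of N is the identity, while
    \<open>P k\<close> is the identity because the k-th power of N vanishes. The constant trace is
    thus both 0 and \<open>trace N\<close>.\<close>
  have "trace (N ** P j) = 0" for j
  proof (induction j)
    case 0
    show ?case using ker[of 0] by (simp add: trace_def)
  qed (simp add: step)
  moreover have "P k = mat 1"
    using absorb[of k "mat 1"] assms by simp
  ultimately show ?thesis by (metis matrix_mul_rid)
qed


section \<open>Jordan homomorphisms fixing the diagonal matrix units\<close>

definition complex_linear :: "('m::finite cmat \<Rightarrow> 's::finite cmat) \<Rightarrow> bool" where
  "complex_linear f \<longleftrightarrow> (\<forall>x y. f (x + y) = f x + f y) \<and> (\<forall>c x. f (cscale c x) = cscale c (f x))"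

lemma complex_linear_add: "complex_linear f \<Longrightarrow> f (x + y) = f x + f y"
  and complex_linear_cscale: "complex_linear f \<Longrightarrow> f (cscale c x) = cscale c (f x)"
  by (simp_all add: complex_linear_def)

lemma complex_linear_0: "complex_linear f \<Longrightarrow> f 0 = 0"
  using complex_linear_cscale[of f 0 0] by simp

lemma complex_linear_diff: "complex_linear f \<Longrightarrow> f (x - y) = f x - f y"
  by (metis add_diff_cancel_right' complex_linear_add diff_add_cancel)

lemma complex_linear_sum: "complex_linear f \<Longrightarrow> f (\<Sum>i\<in>I. g i) = (\<Sum>i\<in>I. f (g i))"
  by (induction I rule: infinite_finite_induct) (auto simp: complex_linear_0 complex_linear_add)

definition matrix_unit :: "'k \<Rightarrow> 'k \<Rightarrow> 'k::finite cmat" where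
  "matrix_unit i j = (\<chi> k l. if k = i \<and> l = j then 1 else 0)"

lemma matrix_unit_nth: "matrix_unit i j $ k $ l = (if k = i \<and> l = j then 1 else 0)"
  by (simp add: matrix_unit_def)

lemma matrix_unit_left_nth: "(matrix_unit i j ** y) $ k $ l = (if k = i then y $ j $ l else 0)"
  by (auto simp: mult_nth matrix_unit_nth if_distrib[of "\<lambda>a. a * _"] cong: if_cong)

lemma matrix_unit_right_nth:
  "(y ** matrix_unit i j) $ k $ l = (if l = j then y $ k $ i else 0)"
  by (auto simp: mult_nth matrix_unit_nth if_distrib cong: if_cong)

lemma matrix_unit_mult:
  "matrix_unit i j ** matrix_unit k l = (if j = k then matrix_unit i l else 0)"
  by (auto simp: cmat_eq_iff matrix_unit_left_nth matrix_unit_nth)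

lemma sum_matrix_unit_diag: "(\<Sum>i\<in>UNIV. matrix_unit i i) = mat 1"
  by (auto simp: cmat_eq_iff matrix_unit_nth mat_def intro: sum.neutral)

lemma matrix_unit_expansion: "(\<Sum>i\<in>UNIV. \<Sum>j\<in>UNIV. cscale (x $ i $ j) (matrix_unit i j)) = x"
  (is "?S = x")
proof -
  have "?S $ k $ l = (\<Sum>i\<in>UNIV. if i = k then \<Sum>j\<in>UNIV. if j = l then x $ i $ j else 0 else 0)" for k l
    unfolding sum_component cscale_nth matrix_unit_nth
  proof (intro sum.cong refl)
    fix i
    show "(\<Sum>j\<in>UNIV. x $ i $ j * (if k = i \<and> l = j then 1 else 0)) =
        (if i = k then \<Sum>j\<in>UNIV. if j = l then x $ i $ j else 0 else 0)"
      by (cases "i = k") (auto simp: if_distrib cong: if_cong)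
  qed
  then show ?thesis
    by (simp add: cmat_eq_iff)
qed

lemma complex_linear_expansion:
  assumes "complex_linear f"
  shows "f x = (\<Sum>i\<in>UNIV. \<Sum>j\<in>UNIV. cscale (x $ i $ j) (f (matrix_unit i j)))"
proof -
  have "f x = f (\<Sum>i\<in>UNIV. \<Sum>j\<in>UNIV. cscale (x $ i $ j) (matrix_unit i j))"
    by (simp add: matrix_unit_expansion)
  then show ?thesis
    by (simp only: complex_linear_sum[OF assms] complex_linear_cscale[OF assms])
qed

text \<open>Fix a base index e and take \<open>d i = a i e\<close>.\<close>

lemma multiplicative_cocycle:
  fixes a :: "'i \<Rightarrow> 'i \<Rightarrow> complex"
  assumes "\<And>i. a i i = 1" and "\<And>i j k. a i k = a i j * a j k"
  obtains d where "\<And>i. d i \<noteq> 0" "\<And>i j. a i j = d i / d j"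
proof
  define e where "e = (undefined :: 'i)"
  have 1: "a i j * a j i = 1" for i j
    using assms by metis
  then show "a i e \<noteq> 0" for i
    by (metis mult_zero_left zero_neq_one)
  then show "a i j = a i e / a j e" for i j
    using assms(2)[of i e j] by (simp add: nonzero_eq_divide_eq)
qed

text \<open>The Jordan products with the i-th and j-th diagonal units confine the image of
  \<open>matrix_unit i j\<close> to the span of itself and its transpose. One of the two
  coefficients vanishes, the choice is the same for all pairs, and the surviving coefficients form a
  multiplicative cocycle.\<close>

theorem jordan_hom_fixing_diagonal:
  fixes J :: "'m::finite cmat \<Rightarrow> 'm cmat"
  assumes lin: "complex_linear J" and sq: "\<And>x. J x ** J x = J (x ** x)"
    and diag: "\<And>i. J (matrix_unit i i) = matrix_unit i i"
  obtains d where "\<And>i. d i \<noteq> 0"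
    "(\<forall>x. J x = (\<chi> i j. d i * x $ i $ j / d j)) \<or> (\<forall>x. J x = (\<chi> i j. d i * x $ j $ i / d j))"
proof -
  have jordan: "J x ** J y + J y ** J x = J (x ** y + y ** x)" for x y
    using sq[of "x + y"] sq[of x] sq[of y]
    by (simp add: complex_linear_add[OF lin] matrix_add_ldistrib matrix_add_rdistrib algebra_simps)
  define \<alpha> \<beta> where "\<alpha> i j = J (matrix_unit i j) $ i $ j" and "\<beta> i j = J (matrix_unit i j) $ j $ i" for i j
  have J: "J (matrix_unit i j) = cscale (\<alpha> i j) (matrix_unit i j) + cscale (\<beta> i j) (matrix_unit j i)"
    if "i \<noteq> j" for i j
  proof -
    define y where "y = J (matrix_unit i j)"
    have eq: "matrix_unit i i ** y + y ** matrix_unit i i = y" "matrix_unit j j ** y + y ** matrix_unit j j = y"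
      using jordan[of "matrix_unit i i" "matrix_unit i j"] jordan[of "matrix_unit j j" "matrix_unit i j"] that
      by (simp_all add: diag matrix_unit_mult y_def)
    have "(if k = i then y $ k $ l else 0) + (if l = i then y $ k $ l else 0) = y $ k $ l"
      "(if k = j then y $ k $ l else 0) + (if l = j then y $ k $ l else 0) = y $ k $ l" for k l
      using arg_cong[OF eq(1), of "\<lambda>y. y $ k $ l"] arg_cong[OF eq(2), of "\<lambda>y. y $ k $ l"]
      by (simp_all add: matrix_unit_left_nth matrix_unit_right_nth cong: if_cong)
    then have "y $ k $ l = 0" if "(k, l) \<noteq> (i, j)" "(k, l) \<noteq> (j, i)" for k l
      using that \<open>i \<noteq> j\<close> by (smt (verit) add.right_neutral add_cancel_right_left)
    then show ?thesis
      using that by (auto simp: cmat_eq_iff matrix_unit_nth \<alpha>_def \<beta>_def y_def)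
  qed
  note expand = matrix_add_ldistrib matrix_add_rdistrib matrix_unit_mult cscale_add_right
  have \<alpha>\<beta>: "\<alpha> i j * \<beta> i j = 0" if "i \<noteq> j" for i j
  proof -
    have "(J (matrix_unit i j) ** J (matrix_unit i j)) $ i $ i = 0"
      using that by (simp add: sq matrix_unit_mult complex_linear_0[OF lin])
    then show ?thesis
      using that by (auto simp: J expand matrix_unit_nth)
  qed
  have inv: "\<alpha> i j * \<alpha> j i + \<beta> i j * \<beta> j i = 1" if "i \<noteq> j" for i j
  proof -
    have "(J (matrix_unit i j) ** J (matrix_unit j i) + J (matrix_unit j i) ** J (matrix_unit i j)) $ i $ i
        = (matrix_unit i i + matrix_unit j j) $ i $ i"
      using that by (simp add: jordan matrix_unit_mult complex_linear_add[OF lin] diag)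
    then show ?thesis
      using that by (simp add: J expand matrix_unit_nth mult.commute)
  qed
  have chain: "\<alpha> i k = \<alpha> i j * \<alpha> j k" "\<beta> i k = \<beta> i j * \<beta> j k" if "i \<noteq> j" "j \<noteq> k" "i \<noteq> k" for i j k
  proof -
    have eq: "J (matrix_unit i j) ** J (matrix_unit j k) + J (matrix_unit j k) ** J (matrix_unit i j)
        = J (matrix_unit i k)"
      using that by (simp add: jordan matrix_unit_mult)
    show "\<alpha> i k = \<alpha> i j * \<alpha> j k"
      using arg_cong[OF eq, of "\<lambda>y. y $ i $ k"] that by (simp add: J expand matrix_unit_nth mult.commute)
    show "\<beta> i k = \<beta> i j * \<beta> j k"
      using arg_cong[OF eq, of "\<lambda>y. y $ k $ i"] that by (simp add: J expand matrix_unit_nth mult.commute)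
  qed
  \<comment> \<open>The condition \<open>\<beta> i j = 0\<close> says that the pair (i, j) is not
    transposed. It spreads to the reversed pair, to pairs starting at j, and so to all
    pairs.\<close>
  have type_sym: "\<beta> j i = 0" if "\<beta> i j = 0" "i \<noteq> j" for i j
    using inv[of i j] \<alpha>\<beta>[of j i] that by auto
  have type_chain: "\<beta> j k = 0" if "\<beta> i j = 0" "i \<noteq> j" "j \<noteq> k" for i j k
  proof (cases "i = k")
    case False
    show ?thesis
    proof (rule ccontr)
      assume "\<beta> j k \<noteq> 0"
      then have "\<alpha> j k = 0" using \<alpha>\<beta>[of j k] that by simp
      then have "\<alpha> i k = 0" "\<beta> i k = 0" using chain[of i j k] that False by auto
      then show False using inv[of i k] False by simp
    qed
  qed (use that type_sym in auto)
  have uniform: "\<beta> k l = 0" if "\<beta> i j = 0" "i \<noteq> j" "k \<noteq> l" for i j k l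
  proof (cases "j = k")
    case False
    then have "\<beta> j k = 0" using type_chain that by blast
    then show ?thesis using type_chain False that by blast
  qed (use that type_chain in blast)
  consider (hom) "\<And>i j. i \<noteq> j \<Longrightarrow> \<beta> i j = 0" | (anti) "\<And>i j. i \<noteq> j \<Longrightarrow> \<alpha> i j = 0"
    using uniform \<alpha>\<beta> by (metis mult_eq_0_iff)
  then show ?thesis
  proof cases
    case hom
    define a where "a i j = (if i = j then 1 else \<alpha> i j)" for i j
    have diag_1: "a i i = 1" for i
      by (simp add: a_def)
    have coc: "a i k = a i j * a j k" for i j k
      using chain[of i j k] inv[of i j] hom by (auto simp: a_def)
    from multiplicative_cocycle[of a, OF diag_1 coc]
    obtain d where d: "\<And>i. d i \<noteq> 0" "\<And>i j. a i j = d i / d j"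
      by blast
    have "J (matrix_unit i j) = cscale (a i j) (matrix_unit i j)" for i j
      using J[of i j] hom[of i j] diag by (auto simp: a_def)
    then have "J x = (\<Sum>i\<in>UNIV. \<Sum>j\<in>UNIV. cscale ((\<chi> i j. d i * x $ i $ j / d j) $ i $ j) (matrix_unit i j))" for x
      by (subst complex_linear_expansion[OF lin]) (simp add: d(2) mult.commute)
    then have "\<forall>x. J x = (\<chi> i j. d i * x $ i $ j / d j)"
      by (simp only: matrix_unit_expansion) blast
    with d(1) show ?thesis using that by blast
  next
    case anti
    define b where "b i j = (if i = j then 1 else \<beta> i j)" for i j
    have diag_1: "b i i = 1" for i
      by (simp add: b_def)
    have coc: "b i k = b i j * b j k" for i j k
      using chain[of i j k] inv[of i j] anti by (auto simp: b_def)
    from multiplicative_cocycle[of b, OF diag_1 coc]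
    obtain d where d: "\<And>i. d i \<noteq> 0" "\<And>i j. b i j = d i / d j"
      by blast
    have "J (matrix_unit i j) = cscale (b i j) (matrix_unit j i)" for i j
      using J[of i j] anti[of i j] diag by (auto simp: b_def)
    \<comment> \<open>Here \<open>matrix_unit i j\<close> goes to a multiple of
      \<open>matrix_unit j i\<close>, so the row index of the image is j, and the factor
      \<open>d i / d j\<close> takes the required shape only with d replaced by its inverse.\<close>
    then have "J x = (\<Sum>j\<in>UNIV. \<Sum>i\<in>UNIV. cscale ((\<chi> i j. inverse (d i) * x $ j $ i / inverse (d j)) $ j $ i) (matrix_unit j i))" for x
      by (subst complex_linear_expansion[OF lin], subst sum.swap) (simp add: d(2) field_simps)
    then have "\<forall>x. J x = (\<chi> i j. inverse (d i) * x $ j $ i / inverse (d j))"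
      by (simp only: matrix_unit_expansion) blast
    with d(1) show ?thesis using that[of "\<lambda>i. inverse (d i)"] by auto
  qed
qed


section \<open>Families of linear maps preserving orthogonality of projections\<close>

definition projection_matrix :: "'k::finite cmat \<Rightarrow> bool" where
  "projection_matrix p \<longleftrightarrow> self_adjoint p \<and> p ** p = p"

lemma projection_matrix_complement:
  assumes "projection_matrix p"
  shows "projection_matrix (mat 1 - p)" "p ** (mat 1 - p) = 0" "(mat 1 - p) ** p = 0"
  using assms
  by (simp_all add: projection_matrix_def self_adjoint_iff matrix_diff_ldistrib matrix_diff_rdistrib)

lemma projection_matrix_unit: "projection_matrix (matrix_unit i i)"
  by (auto simp: projection_matrix_def self_adjoint_iff cmat_eq_iff matrix_unit_nth matrix_unit_mult)

lemma orthogonal_projections_projection: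
  "orthogonal_projections N p \<Longrightarrow> i < N \<Longrightarrow> projection_matrix (p i)"
  by (auto simp: orthogonal_projections_def projection_matrix_def)

lemma cartesian_decomposition:
  obtains a b where "self_adjoint a" "self_adjoint b" "x = a + cscale \<i> b"
proof
  show "self_adjoint (cscale (1/2) (x + adjoint_matrix x))"
    "self_adjoint (cscale (\<i>/2) (adjoint_matrix x - x))"
    by (auto simp: self_adjoint_iff cmat_eq_iff algebra_simps)
  show "x = cscale (1/2) (x + adjoint_matrix x) + cscale \<i> (cscale (\<i>/2) (adjoint_matrix x - x))"
    by (simp add: cmat_eq_iff algebra_simps)
qed

text \<open>Projections span the matrix algebra, by the spectral theorem and the Cartesian
  decomposition.\<close>

lemma complex_linear_eqI:
  assumes f: "complex_linear f" and g: "complex_linear g"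
    and eq: "\<And>p. projection_matrix p \<Longrightarrow> f p = g p"
  shows "f x = g x"
proof -
  have sa: "f a = g a" if a: "self_adjoint a" for a
  proof -
    obtain N p t where p: "orthogonal_projections N p" "(\<Sum>i<N. p i) = mat 1"
      and pow: "\<And>n. mpow a n = (\<Sum>i<N. cscale (of_real (t i ^ n)) (p i))"
      using spectral_decomposition[OF a] by metis
    have "a = (\<Sum>i<N. cscale (of_real (t i)) (p i))"
      using pow[of 1] by simp
    then show ?thesis
      using eq orthogonal_projections_projection[OF p(1)]
      by (simp add: complex_linear_sum f g complex_linear_cscale)
  qed
  obtain a b where "self_adjoint a" "self_adjoint b" "x = a + cscale \<i> b"
    by (rule cartesian_decomposition)
  then show ?thesis
    by (simp add: complex_linear_add complex_linear_cscale f g sa)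
qed

lemma complex_linear_mult:
  "complex_linear f \<Longrightarrow> complex_linear (\<lambda>x. (A :: 's::finite cmat) ** f x)"
  "complex_linear f \<Longrightarrow> complex_linear (\<lambda>x. f x ** (A :: 's::finite cmat))"
  by (auto simp: complex_linear_def matrix_add_ldistrib matrix_add_rdistrib)

text \<open>The (k, j) entry of the commutation relation with \<open>matrix_unit i j\<close> shows
  that A is diagonal with constant diagonal.\<close>

lemma central_matrix_scalar:
  fixes A :: "'k::finite cmat"
  assumes "\<And>y. A ** y = y ** A"
  obtains c where "A = cscale c (mat 1)"
proof
  have "A $ k $ i = (if k = i then A $ j $ j else 0)" for i j k
    using arg_cong[OF assms[of "matrix_unit i j"], of "\<lambda>y. y $ k $ j"]
    by (simp add: matrix_unit_left_nth matrix_unit_right_nth)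
  then show "A = cscale (A $ undefined $ undefined) (mat 1)"
    by (simp add: cmat_eq_iff mat_def) metis
qed

text \<open>V is injective, so its range has dimension \<open>CARD('m)\<close>. If the cardinalities
  agree, V is also onto. The index types may differ even then, so V is treated as
  rectangular.\<close>

lemma left_invertible_card_le:
  fixes V :: "complex^'m^'s"
  assumes "B ** V = mat 1"
  shows "CARD('m) \<le> CARD('s)"
    and "CARD('m) = CARD('s) \<Longrightarrow> V ** B = mat 1"
proof -
  have inj: "inj ((*v) V)"
    using assms matrix_left_invertible_injective by blast
  have dim: "vec.dim (range ((*v) V)) = CARD('m)"
    using vec.dim_image_eq[OF matrix_vector_mul_linear_gen[of V], of UNIV] inj
    by (metis inj_on_subset subset_UNIV vec_dim_card)
  then show "CARD('m) \<le> CARD('s)"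
    by (metis vec.dim_subset_UNIV vec.dimension_def vec_dim_card vec.dim_UNIV)
  assume eq: "CARD('m) = CARD('s)"
  have "vec.span (range ((*v) V)) = UNIV"
    using dim eq by (simp add: vec.dimension_def card_cart_basis flip: vec.dim_eq_full)
  moreover have "vec.subspace (range ((*v) V))"
    by (metis matrix_vector_mul_linear_gen vec.linear_subspace_image vec.subspace_UNIV)
  ultimately have "surj ((*v) V)"
    by (simp add: vec.span_eq_iff[THEN iffD2])
  then obtain C where C: "V ** C = mat 1"
    using matrix_right_invertible_surjective[of V] by auto
  have "B ** (V ** C) = C"
    by (simp only: matrix_mul_assoc assms matrix_mul_lid)
  with C show "V ** B = mat 1"
    by simp
qed

lemma invertible_matrix_inv:
  assumes "invertible S"
  shows "S ** matrix_inv S = mat 1" "matrix_inv S ** S = mat 1"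
  using someI_ex[OF assms[unfolded invertible_def]] by (simp_all add: matrix_inv_def)

text \<open>The maps stand for the linearised Taylor coefficients of H. Orthogonality is asked
  across different degrees j and k, which later ties all of them to a single one.\<close>

locale projection_orthogonality_preserving =
  fixes \<phi> :: "nat \<Rightarrow> 'm::finite cmat \<Rightarrow> 's::finite cmat"
  assumes linear: "complex_linear (\<phi> k)"
    and orth: "projection_matrix p \<Longrightarrow> projection_matrix q \<Longrightarrow> p ** q = 0 \<Longrightarrow> \<phi> j p ** \<phi> k q = 0"
begin

lemma at_1: "\<phi> j (mat 1) = \<phi> j p + \<phi> j (mat 1 - p)"
  by (simp flip: complex_linear_add[OF linear])

text \<open>Split the identity as p + (1 - p); the mixed products vanish by orthogonality.\<close>

lemma square_projection:
  assumes "projection_matrix p"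
  shows "\<phi> j (mat 1) ** \<phi> j p = \<phi> j p ** \<phi> j p" "\<phi> j p ** \<phi> j (mat 1) = \<phi> j p ** \<phi> j p"
  using projection_matrix_complement[OF assms] assms
  by (simp_all add: at_1[of j p] matrix_add_ldistrib matrix_add_rdistrib orth)

lemma commute: "\<phi> j (mat 1) ** \<phi> j x = \<phi> j x ** \<phi> j (mat 1)"
proof (rule complex_linear_eqI[of "\<lambda>x. \<phi> j (mat 1) ** \<phi> j x" "\<lambda>x. \<phi> j x ** \<phi> j (mat 1)"])
qed (simp_all add: complex_linear_mult linear square_projection)

text \<open>Both sides are quadratic in a, so agreement on projections is not enough. Diagonalising
  a turns the left side into a double sum in which only diagonal terms survive.\<close>

lemma square_self_adjoint:
  assumes "self_adjoint a"
  shows "\<phi> j a ** \<phi> j a = \<phi> j (mat 1) ** \<phi> j (a ** a)"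
proof -
  obtain N p t where p: "orthogonal_projections N p" "(\<Sum>i<N. p i) = mat 1"
    and pow: "\<And>n. mpow a n = (\<Sum>i<N. cscale (of_real (t i ^ n)) (p i))"
    using spectral_decomposition[OF assms] by metis
  have proj: "projection_matrix (p i)" if "i < N" for i
    using orthogonal_projections_projection[OF p(1) that] .
  have pp: "\<phi> j (p i) ** \<phi> j (p k) = (if i = k then \<phi> j (mat 1) ** \<phi> j (p i) else 0)"
    if "i < N" "k < N" for i k
    using that p proj orth[of "p i" "p k"] square_projection
    by (auto simp: orthogonal_projections_def)
  have a: "\<phi> j a = (\<Sum>i<N. cscale (of_real (t i)) (\<phi> j (p i)))"
    using pow[of 1] by (simp add: complex_linear_sum[OF linear] complex_linear_cscale[OF linear])
  have aa: "\<phi> j (a ** a) = (\<Sum>i<N. cscale (of_real (t i ^ 2)) (\<phi> j (p i)))"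
    using pow[of 2]
    by (simp add: complex_linear_sum[OF linear] complex_linear_cscale[OF linear] numeral_2_eq_2)
  have "\<phi> j a ** \<phi> j a =
      (\<Sum>i<N. \<Sum>k<N. cscale (of_real (t i * t k)) (\<phi> j (p i) ** \<phi> j (p k)))"
    by (simp add: a matrix_sum_ldistrib matrix_sum_rdistrib cscale_sum mult.commute)
      (subst sum.swap, simp add: mult.commute)
  also have "\<dots> = (\<Sum>i<N. \<Sum>k<N. if k = i then cscale (of_real (t i ^ 2)) (\<phi> j (mat 1) ** \<phi> j (p i)) else 0)"
    by (intro sum.cong refl) (auto simp: pp power2_eq_square)
  also have "\<dots> = \<phi> j (mat 1) ** \<phi> j (a ** a)"
    by (simp add: aa matrix_sum_ldistrib)
  finally show ?thesis .
qed

lemma square: "\<phi> j x ** \<phi> j x = \<phi> j (mat 1) ** \<phi> j (x ** x)"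
proof -
  note expand = matrix_add_ldistrib matrix_add_rdistrib complex_linear_add[OF linear]
    complex_linear_cscale[OF linear] cscale_add_right
  obtain a b where ab: "self_adjoint a" "self_adjoint b" "x = a + cscale \<i> b"
    by (rule cartesian_decomposition)
  \<comment> \<open>The self-adjoint case for a + b, minus those for a and b, yields the mixed terms
    of the square of a + ib.\<close>
  have "self_adjoint (a + b)"
    using ab by (simp add: self_adjoint_iff)
  from square_self_adjoint[OF this, of j] square_self_adjoint[OF ab(1), of j]
    square_self_adjoint[OF ab(2), of j]
  have "\<phi> j a ** \<phi> j b + \<phi> j b ** \<phi> j a
      = \<phi> j (mat 1) ** \<phi> j (a ** b) + \<phi> j (mat 1) ** \<phi> j (b ** a)"
    by (simp add: expand algebra_simps)
  then have "cscale \<i> (\<phi> j a ** \<phi> j b) + cscale \<i> (\<phi> j b ** \<phi> j a)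
      = cscale \<i> (\<phi> j (mat 1) ** \<phi> j (a ** b)) + cscale \<i> (\<phi> j (mat 1) ** \<phi> j (b ** a))"
    by (simp flip: cscale_add_right)
  then show ?thesis
    using square_self_adjoint[OF ab(1), of j] square_self_adjoint[OF ab(2), of j]
    by (simp add: ab(3) expand algebra_simps)
qed

lemma jordan:
  "\<phi> j x ** \<phi> j y + \<phi> j y ** \<phi> j x = \<phi> j (mat 1) ** \<phi> j (x ** y + y ** x)"
  using square[of j "x + y"] square[of j x] square[of j y]
  by (simp add: complex_linear_add[OF linear] matrix_add_ldistrib matrix_add_rdistrib algebra_simps)

text \<open>Being annihilated by a power of \<open>\<phi> j (mat 1)\<close> passes from x to its
  Jordan products, at the cost of one more factor.\<close>

lemma annihilator_jordan:
  assumes "mpow (\<phi> j (mat 1)) n ** \<phi> j x = 0"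
  shows "mpow (\<phi> j (mat 1)) (Suc n) ** \<phi> j (x ** y + y ** x) = 0"
proof -
  let ?c = "mpow (\<phi> j (mat 1)) n"
  have "mpow (\<phi> j (mat 1)) (Suc n) ** \<phi> j (x ** y + y ** x)
      = ?c ** (\<phi> j x ** \<phi> j y + \<phi> j y ** \<phi> j x)"
    by (simp add: jordan mpow_Suc_right matrix_mul_assoc del: mpow.simps)
  also have "\<dots> = ?c ** \<phi> j x ** \<phi> j y + \<phi> j y ** (?c ** \<phi> j x)"
    by (metis (no_types) commute matrix_add_ldistrib matrix_mul_assoc mpow_commute)
  finally show ?thesis using assms by simp
qed

text \<open>If \<open>h\<^sup>2 \<phi>(E\<^sub>i\<^sub>i) = 0\<close> for one \<open>i\<close>, where \<open>h = \<phi>(1)\<close>, then \<open>h\<^sup>5 = 0\<close>, and the values of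
  \<open>\<phi>\<close> are nilpotent because \<open>\<phi>(x)\<^sup>2 = h \<phi>(x\<^sup>2)\<close>.\<close>

lemma cube_matrix_unit_nonzero:
  assumes "trace (\<phi> j x) \<noteq> 0"
  shows "\<phi> j (matrix_unit i i) ** \<phi> j (matrix_unit i i) ** \<phi> j (matrix_unit i i) \<noteq> 0"
proof
  let ?h = "\<phi> j (mat 1)"
  let ?e = "\<lambda>k l. \<phi> j (matrix_unit k l)"
  assume "?e i i ** ?e i i ** ?e i i = 0"
  then have "?h ** (?h ** ?e i i) = 0"
    by (metis commute matrix_mul_assoc projection_matrix_unit square_projection(1))
  then have 2: "mpow ?h 2 ** ?e i i = 0"
    by (simp add: numeral_2_eq_2 matrix_mul_assoc)
  have 4: "mpow ?h 4 ** ?e i i = 0"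
    using 2 mpow_add[of ?h 2 2] by (simp flip: matrix_mul_assoc)
  \<comment> \<open>Two Jordan products lead from the i-th diagonal unit through
    \<open>matrix_unit i k\<close> to the sum of the i-th and k-th diagonal units, raising the
    exponent from 2 to 4.\<close>
  have diag: "mpow ?h 4 ** ?e k k = 0" for k
  proof (cases "k = i")
    case False
    have "mpow ?h 3 ** ?e i k = 0"
      using annihilator_jordan[OF 2, of "matrix_unit i k"] False
      by (simp add: matrix_unit_mult numeral_3_eq_3 numeral_2_eq_2)
    from annihilator_jordan[OF this, of "matrix_unit k i"]
    have "mpow ?h 4 ** (?e i i + ?e k k) = 0"
      by (simp add: matrix_unit_mult complex_linear_add[OF linear] del: mpow.simps)
    then show ?thesis
      using 4 by (simp add: matrix_add_ldistrib)
  qed (simp add: 4)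
  have "?h = (\<Sum>k\<in>UNIV. ?e k k)"
    by (simp add: complex_linear_sum[OF linear] flip: sum_matrix_unit_diag)
  then have "X ** ?h = (\<Sum>k\<in>UNIV. X ** ?e k k)" for X :: "'s cmat"
    by (simp only: matrix_sum_ldistrib)
  then have "mpow ?h 4 ** ?h = 0"
    by (simp add: diag)
  then have h: "mpow ?h 5 = 0"
    using mpow_Suc_right[of ?h 4] by simp
  have "mpow (\<phi> j x) (2 * 5) = mpow (?h ** \<phi> j (x ** x)) 5"
    unfolding mpow_mult by (simp add: square numeral_2_eq_2)
  also have "\<dots> = 0"
    by (simp add: mpow_mult_commute commute h)
  finally show False
    using trace_nilpotent assms by blast
qed

text \<open>With \<open>?e i\<close> the image of the i-th diagonal unit, choose \<open>w i\<close>
  not killed by its cube; the columns of V are the vectors \<open>?e i *v w i\<close>. Since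
  \<open>?e i ** ?e k\<close> vanishes for distinct indices, applying \<open>?e i\<close> isolates
  the i-th coefficient. The cube equals \<open>?h ** ?h ** ?e i\<close>, so independence survives
  multiplication by \<open>?h\<close>.\<close>

lemma diagonalising_basis:
  assumes "trace (\<phi> j x) \<noteq> 0"
  obtains V :: "complex^'m^'s" and B :: "complex^'s^'m"
    where "B ** V = mat 1" "\<And>i. \<phi> j (matrix_unit i i) ** V = \<phi> j (mat 1) ** V ** matrix_unit i i"
      "\<And>c. \<phi> j (mat 1) *v (V *v c) = 0 \<Longrightarrow> c = 0"
proof -
  let ?h = "\<phi> j (mat 1)"
  let ?e = "\<lambda>i. \<phi> j (matrix_unit i i)"
  have "\<forall>i. \<exists>w. (?e i ** ?e i ** ?e i) *v w \<noteq> 0"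
    using cube_matrix_unit_nonzero[OF assms] by (metis matrix_eq matrix_vector_mult_0)
  then obtain w where w: "\<And>i. ?e i *v (?e i *v (?e i *v w i)) \<noteq> 0"
    unfolding matrix_vector_mul_assoc[symmetric] by metis
  define V where "V = (\<chi> a i. (?e i *v w i) $ a)"
  have V: "V *v c = (\<Sum>i\<in>UNIV. c $ i *s (?e i *v w i))" for c
    by (simp add: matrix_mult_sum V_def column_def vec_eq_iff)
  have ee: "?e i ** ?e k = (if i = k then ?h ** ?e i else 0)" for i k
    using orth[OF projection_matrix_unit projection_matrix_unit, of i k]
    by (auto simp: matrix_unit_mult square_projection(1)[OF projection_matrix_unit])
  have eV: "?e i *v (V *v c) = c $ i *s (?h *v (?e i *v w i))" for i c
  proof -
    have "?e i *v (V *v c) = (\<Sum>k\<in>UNIV. c $ k *s ((?e i ** ?e k) *v w k))"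
      by (simp add: V vec.linear_sum[OF matrix_vector_mul_linear_gen] vector_scalar_commute
          matrix_vector_mul_assoc)
    also have "\<dots> = (\<Sum>k\<in>UNIV. if k = i then c $ i *s (?h *v (?e i *v w i)) else 0)"
      by (intro sum.cong) (auto simp: ee matrix_vector_mul_assoc)
    finally show ?thesis by simp
  qed
  have ehe: "?e i *v (?h *v (?e i *v w i)) \<noteq> 0" for i
    using w[of i] by (metis commute matrix_mul_assoc matrix_vector_mul_assoc projection_matrix_unit square_projection(1))
  have injV: "c = 0" if "V *v c = 0" for c
  proof -
    have "c $ i *s (?e i *v (?h *v (?e i *v w i))) = 0" for i
      using eV[of i c] that by (metis matrix_vector_mult_0_right vector_scalar_commute)
    then show ?thesis using ehe by (simp add: vec_eq_iff) (metis vector_mul_eq_0)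
  qed
  have injhV: "c = 0" if "?h *v (V *v c) = 0" for c
  proof -
    have "?h *v (?e i *v (V *v c)) = 0" for i
      using that by (metis commute matrix_vector_mul_assoc matrix_vector_mult_0_right)
    then have "c $ i *s (?h *v (?h *v (?e i *v w i))) = 0" for i
      by (simp add: eV vector_scalar_commute)
    moreover have "?h *v (?h *v (?e i *v w i)) \<noteq> 0" for i
      using ehe[of i] by (metis commute ee matrix_vector_mul_assoc)
    ultimately show ?thesis by (simp add: vec_eq_iff) (metis vector_mul_eq_0)
  qed
  obtain B where B: "B ** V = mat 1"
    using injV matrix_left_invertible_ker[of V] by blast
  have "?e i ** V = ?h ** V ** matrix_unit i i" for i
  proof -
    have "matrix_unit i i *v c = c $ i *s axis i 1" for c :: "complex^'m"
      by (auto simp: vec_eq_iff matrix_vector_mult_def matrix_unit_nth axis_def if_distrib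
          if_distribR cong: if_cong)
    moreover have "V *v axis i 1 = ?e i *v w i"
      by (simp add: V_def vec_eq_iff matrix_vector_mult_def axis_def if_distrib cong: if_cong)
    ultimately show ?thesis
      by (simp add: matrix_eq eV vector_scalar_commute flip: matrix_vector_mul_assoc)
  qed
  from that[OF B this injhV] show ?thesis by blast
qed

lemma card_le:
  assumes "trace (\<phi> j x) \<noteq> 0"
  shows "CARD('m) \<le> CARD('s)"
  using diagonalising_basis[OF assms] left_invertible_card_le(1) by metis

text \<open>The size bound makes V invertible, and then h, the value at the identity, is invertible
  too. Conjugating the product of the inverse of h with \<open>\<phi> j\<close> by V gives a Jordan
  homomorphism J fixing the diagonal units. The diagonal matrix of its scalars is absorbed into S
  and T.\<close>

lemma jordan_factorisation:
  assumes "trace (\<phi> j x) \<noteq> 0" and "CARD('s) \<le> CARD('m)"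
  obtains S :: "complex^'s^'m" and T :: "complex^'m^'s" and K
    where "S ** T = mat 1" "T ** S = mat 1" "K ** \<phi> j (mat 1) = mat 1"
      "(\<forall>x. \<phi> j x = \<phi> j (mat 1) ** (T ** x ** S)) \<or>
       (\<forall>x. \<phi> j x = \<phi> j (mat 1) ** (T ** transpose x ** S))"
proof -
  let ?h = "\<phi> j (mat 1)"
  obtain V B where BV: "B ** V = mat 1"
    and eV: "\<And>i. \<phi> j (matrix_unit i i) ** V = ?h ** V ** matrix_unit i i"
    and inj: "\<And>c. ?h *v (V *v c) = 0 \<Longrightarrow> c = 0"
    by (rule diagonalising_basis[OF assms(1)]) blast
  have VB: "V ** B = mat 1"
    using left_invertible_card_le[OF BV] assms(2) by auto
  have "v = 0" if "?h *v v = 0" for v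
    using inj[of "B *v v"] that VB
    by (metis matrix_vector_mul_assoc matrix_vector_mul_lid matrix_vector_mult_0_right)
  then obtain K where Kh: "K ** ?h = mat 1"
    using matrix_left_invertible_ker[of ?h] by blast
  then have hK: "?h ** K = mat 1"
    by (simp add: matrix_left_right_inverse)
  have K: "K ** \<phi> j x = \<phi> j x ** K" for x
    by (metis Kh commute hK matrix_mul_assoc matrix_mul_lid matrix_mul_rid)
  define J where "J x = B ** (K ** \<phi> j x) ** V" for x
  have \<phi>: "\<phi> j x = ?h ** (V ** J x ** B)" for x
    unfolding J_def by (metis VB hK matrix_mul_assoc matrix_mul_lid matrix_mul_rid)
  have "complex_linear J"
    unfolding complex_linear_def J_def
    by (simp add: complex_linear_add[OF linear] complex_linear_cscale[OF linear]
        matrix_add_ldistrib matrix_add_rdistrib) (simp add: cmat_eq_iff mult_nth sum_distrib_left sum_distrib_right ac_simps)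
  moreover have "J x ** J x = J (x ** x)" for x
  proof -
    have "J x ** J x = B ** (K ** \<phi> j x) ** (V ** B) ** (K ** \<phi> j x) ** V"
      by (simp add: J_def matrix_mul_assoc)
    also have "\<dots> = B ** (K ** (K ** (\<phi> j x ** \<phi> j x))) ** V"
      by (simp add: VB) (metis K matrix_mul_assoc)
    also have "\<dots> = J (x ** x)"
      by (simp add: J_def square) (metis Kh matrix_mul_assoc matrix_mul_lid)
    finally show ?thesis .
  qed
  moreover have "J (matrix_unit i i) = matrix_unit i i" for i
    unfolding J_def by (metis BV Kh eV matrix_mul_assoc matrix_mul_lid)
  ultimately obtain d where d: "\<And>i. d i \<noteq> 0"
    "(\<forall>x. J x = (\<chi> i j. d i * x $ i $ j / d j)) \<or> (\<forall>x. J x = (\<chi> i j. d i * x $ j $ i / d j))"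
    by (rule jordan_hom_fixing_diagonal[of J]) blast
  define D D' :: "'m cmat" where "D = (\<chi> i j. if i = j then d i else 0)"
    and "D' = (\<chi> i j. if i = j then inverse (d i) else 0)"
  have D: "(D ** y) $ i $ j = d i * y $ i $ j" "(y ** D') $ i $ j = y $ i $ j / d j" for y :: "'m cmat" and i j
    by (simp_all add: mult_nth D_def D'_def divide_inverse if_distrib if_distribR cong: if_cong)
  have "(D' ** y) $ i $ j = y $ i $ j / d i" for y :: "'m cmat" and i j
    by (simp add: mult_nth D'_def divide_inverse if_distrib if_distribR cong: if_cong)
  then have "D' ** D = mat 1"
    using d(1) by (simp add: cmat_eq_iff) (simp add: D_def mat_def)
  then have DD: "D' ** D = mat 1" "D ** D' = mat 1"
    by (simp_all add: matrix_left_right_inverse)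
  have DxD: "D ** x ** D' = (\<chi> i j. d i * x $ i $ j / d j)" for x
    by (simp add: cmat_eq_iff D)
  have "(\<forall>x. J x = D ** x ** D') \<or> (\<forall>x. J x = D ** transpose x ** D')"
    using d(2) by (simp add: DxD transpose_def)
  then have "(\<forall>x. \<phi> j x = ?h ** (V ** D ** x ** (D' ** B))) \<or>
      (\<forall>x. \<phi> j x = ?h ** (V ** D ** transpose x ** (D' ** B)))"
    using \<phi> by (metis matrix_mul_assoc)
  moreover have "D' ** B ** (V ** D) = mat 1" "V ** D ** (D' ** B) = mat 1"
    by (metis BV DD VB matrix_mul_assoc matrix_mul_rid)+
  ultimately show ?thesis
    using that Kh by blast
qed

text \<open>Cancelling the invertible h from the orthogonality relations leaves
  \<open>J p ** \<phi> k q = 0\<close> and its mirror image. Hence \<open>\<phi> k\<close> is J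
  multiplied, on either side, by its value g at the identity. As J is onto, g is central and
  therefore scalar.\<close>

lemma scalar_multiple:
  assumes J: "complex_linear J" "J (mat 1) = mat 1" "surj J"
    and \<phi>: "\<And>x. \<phi> j x = \<phi> j (mat 1) ** J x" and Kh: "K ** \<phi> j (mat 1) = mat 1"
  obtains c where "\<And>x. \<phi> k x = cscale c (J x)"
proof -
  let ?h = "\<phi> j (mat 1)"
  let ?g = "\<phi> k (mat 1)"
  have hK: "?h ** K = mat 1"
    using Kh by (simp add: matrix_left_right_inverse)
  have hJ: "?h ** J x = J x ** ?h" for x
  proof -
    have "?h ** (?h ** J x) = ?h ** (J x ** ?h)"
      by (metis \<phi> commute matrix_mul_assoc)
    then show ?thesis
      by (metis Kh matrix_mul_assoc matrix_mul_lid)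
  qed
  have left: "J p ** \<phi> k q = 0" and right: "\<phi> k q ** J p = 0"
    if "projection_matrix p" "projection_matrix q" "p ** q = 0" "q ** p = 0" for p q
  proof -
    have "?h ** (J p ** \<phi> k q) = 0"
      using orth[OF that(1-3), of j k] by (simp add: \<phi>[of p] matrix_mul_assoc)
    then show "J p ** \<phi> k q = 0"
      by (metis Kh matrix_mul_assoc matrix_mul_lid times0_right)
    have "\<phi> k q ** J p ** ?h = 0"
      using orth[OF that(2,1,4), of k j] by (simp add: \<phi>[of p] hJ matrix_mul_assoc)
    then show "\<phi> k q ** J p = 0"
      by (metis hK matrix_mul_assoc matrix_mul_rid times0_left)
  qed
  have proj: "\<phi> k p = J p ** ?g" "\<phi> k p = ?g ** J p" if "projection_matrix p" for p
  proof -
    note c = projection_matrix_complement[OF that]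
    have "J p ** \<phi> k (mat 1 - p) = 0" "J (mat 1 - p) ** \<phi> k p = 0"
      using left c that by blast+
    then show "\<phi> k p = J p ** ?g"
      by (simp add: complex_linear_diff[OF linear] complex_linear_diff[OF J(1)] J(2)
          matrix_diff_ldistrib matrix_diff_rdistrib)
    have "\<phi> k (mat 1 - p) ** J p = 0" "\<phi> k p ** J (mat 1 - p) = 0"
      using right c that by blast+
    then show "\<phi> k p = ?g ** J p"
      by (simp add: complex_linear_diff[OF linear] complex_linear_diff[OF J(1)] J(2)
          matrix_diff_ldistrib matrix_diff_rdistrib)
  qed
  have gl: "\<phi> k x = J x ** ?g" and gr: "\<phi> k x = ?g ** J x" for x
    using complex_linear_eqI[OF linear complex_linear_mult(2)[OF J(1)], of k ?g x] proj(1)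
      complex_linear_eqI[OF linear complex_linear_mult(1)[OF J(1)], of k ?g x] proj(2) by blast+
  have "?g ** y = y ** ?g" for y
    by (metis gl gr J(3) surjD)
  then obtain c where "?g = cscale c (mat 1)"
    using central_matrix_scalar by blast
  with gr have "\<phi> k x = cscale c (J x)" for x
    by simp
  then show ?thesis by (rule that)
qed

text \<open>The choice between conjugation and transposed conjugation is made by the one map
  \<open>\<phi> j\<close>, so the disjunction stands outside the quantifier over k.\<close>

theorem conjugation_form:
  assumes "trace (\<phi> j x) \<noteq> 0" and "CARD('s) \<le> CARD('m)"
  obtains lam and S :: "complex^'s^'m"
    where "invertible S"
      "(\<forall>k x. \<phi> k x = cscale (lam k) (matrix_inv S ** x ** S)) \<or>
       (\<forall>k x. \<phi> k x = cscale (lam k) (matrix_inv S ** transpose x ** S))"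
proof -
  obtain S :: "complex^'s^'m" and T K where ST: "S ** T = mat 1" "T ** S = mat 1"
    and K: "K ** \<phi> j (mat 1) = mat 1"
    and \<phi>: "(\<forall>x. \<phi> j x = \<phi> j (mat 1) ** (T ** x ** S)) \<or>
      (\<forall>x. \<phi> j x = \<phi> j (mat 1) ** (T ** transpose x ** S))"
    using jordan_factorisation[OF assms] by metis
  have S: "invertible S"
    using ST unfolding invertible_def by blast
  have T: "matrix_inv S = T"
    by (metis S ST(1) invertible_matrix_inv(2) matrix_mul_assoc matrix_mul_lid matrix_mul_rid)
  have lin: "complex_linear (\<lambda>x. T ** x ** S)" "complex_linear (\<lambda>x. T ** transpose x ** S)"
    by (simp_all add: complex_linear_def cmat_eq_iff mult_nth transpose_def algebra_simps
        sum.distrib sum_distrib_left sum_distrib_right)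
  have TyS: "T ** (S ** y ** T) ** S = y" for y
    by (metis ST(2) matrix_mul_assoc matrix_mul_lid matrix_mul_rid)
  have surj: "surj (\<lambda>x. T ** x ** S)" "surj (\<lambda>x. T ** transpose x ** S)"
    by (rule surjI[of _ "\<lambda>y. S ** y ** T"], rule TyS)
      (rule surjI[of _ "\<lambda>y. transpose (S ** y ** T)"], simp add: TyS)
  from \<phi> show ?thesis
  proof
    assume "\<forall>x. \<phi> j x = \<phi> j (mat 1) ** (T ** x ** S)"
    then have "\<forall>k. \<exists>c. \<forall>x. \<phi> k x = cscale c (T ** x ** S)"
      using scalar_multiple[OF lin(1) _ surj(1) _ K] ST(2) by (metis matrix_mul_rid)
    then obtain lam where "\<forall>k x. \<phi> k x = cscale (lam k) (T ** x ** S)"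
      by metis
    then show ?thesis using that[OF S] T by blast
  next
    assume "\<forall>x. \<phi> j x = \<phi> j (mat 1) ** (T ** transpose x ** S)"
    then have "\<forall>k. \<exists>c. \<forall>x. \<phi> k x = cscale c (T ** transpose x ** S)"
      using scalar_multiple[OF lin(2) _ surj(2) _ K] ST(2)
      by (metis matrix_mul_rid transpose_mat)
    then obtain lam where "\<forall>k x. \<phi> k x = cscale (lam k) (T ** transpose x ** S)"
      by metis
    then show ?thesis using that[OF S] T by blast
  qed
qed

end


section \<open>Orthogonally additive homogeneous polynomials\<close>

text \<open>Serves to extend identities from real to complex t without computing
  coefficients.\<close>

definition polynomial_in :: "(complex \<Rightarrow> complex) \<Rightarrow> bool" where
  "polynomial_in f \<longleftrightarrow> (\<exists>q. \<forall>t. f t = poly q t)"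

lemma polynomial_in_const: "polynomial_in (\<lambda>t. c)"
  unfolding polynomial_in_def by (rule exI[of _ "[:c:]"]) simp

lemma polynomial_in_ident: "polynomial_in (\<lambda>t. t)"
  unfolding polynomial_in_def by (rule exI[of _ "[:0, 1:]"]) simp

lemma polynomial_in_add:
  "polynomial_in f \<Longrightarrow> polynomial_in g \<Longrightarrow> polynomial_in (\<lambda>t. f t + g t)"
  unfolding polynomial_in_def by (auto simp flip: poly_add)

lemma polynomial_in_mult:
  "polynomial_in f \<Longrightarrow> polynomial_in g \<Longrightarrow> polynomial_in (\<lambda>t. f t * g t)"
  unfolding polynomial_in_def by (auto simp flip: poly_mult)

lemma polynomial_in_sum:
  "(\<And>i. i \<in> I \<Longrightarrow> polynomial_in (f i)) \<Longrightarrow> polynomial_in (\<lambda>t. \<Sum>i\<in>I. f i t)"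
  by (induction I rule: infinite_finite_induct) (auto intro: polynomial_in_add polynomial_in_const)

lemma poly_eq_of_real_eq:
  fixes p q :: "complex poly"
  assumes "\<And>t::real. poly p (of_real t) = poly q (of_real t)"
  shows "p = q"
proof (rule ccontr)
  assume "p \<noteq> q"
  then have "finite {z. poly (p - q) z = 0}"
    by (intro poly_roots_finite) simp
  moreover have "range complex_of_real \<subseteq> {z. poly (p - q) z = 0}"
    using assms by auto
  ultimately have "finite (range complex_of_real)"
    by (rule finite_subset[rotated])
  then show False
    using finite_imageD[of complex_of_real UNIV] infinite_UNIV_char_0 by (auto simp: inj_on_def)
qed

lemma polynomial_in_eqI:
  assumes "polynomial_in f" "polynomial_in g" "\<And>t::real. f (of_real t) = g (of_real t)"
  shows "f z = g z"
proof -
  obtain p q where "\<And>t. f t = poly p t" "\<And>t. g t = poly q t"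
    using assms(1,2) by (auto simp: polynomial_in_def)
  then show ?thesis
    using assms(3) poly_eq_of_real_eq[of p q] by simp
qed

section \<open>Symmetric multilinear maps along complex lines\<close>

locale symmetric_multilinear =
  fixes n :: nat and T :: "'m::finite cmat list \<Rightarrow> 's::finite cmat"
  assumes bsm: "bounded_symmetric_multilinear n T"
begin

lemma T_add:
  assumes "length us + Suc (length vs) = n"
  shows "T (us @ (a + b) # vs) = T (us @ a # vs) + T (us @ b # vs)"
proof -
  have "\<forall>xs i a b. length xs = n \<longrightarrow> i < n \<longrightarrow> T (xs[i := a + b]) = T (xs[i := a]) + T (xs[i := b])"
    using bsm unfolding bounded_symmetric_multilinear_def by blast
  from this[rule_format, of "us @ a # vs" "length us" a b] assms show ?thesis
    by simp
qed

lemma T_cscale: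
  assumes "length us + Suc (length vs) = n"
  shows "T (us @ cscale c a # vs) = cscale c (T (us @ a # vs))"
proof -
  have "\<forall>xs i c a. length xs = n \<longrightarrow> i < n \<longrightarrow> T (xs[i := cscale c a]) = cscale c (T (xs[i := a]))"
    using bsm unfolding bounded_symmetric_multilinear_def by blast
  from this[rule_format, of "us @ a # vs" "length us" c a] assms show ?thesis
    by simp
qed

lemma T_perm: "length xs = n \<Longrightarrow> mset ys = mset xs \<Longrightarrow> T ys = T xs"
  using bsm unfolding bounded_symmetric_multilinear_def by blast

lemma T_replicate_cscale:
  "k + length vs = n \<Longrightarrow> T (replicate k (cscale c x) @ vs) = cscale (c ^ k) (T (replicate k x @ vs))"
proof (induction k arbitrary: vs)
  case (Suc k)
  then show ?case
    using Suc.IH[of "cscale c x # vs"] T_cscale[of "replicate k x" vs c x]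
    by (simp flip: replicate_app_Cons_same add: mult.commute)
qed simp

text \<open>Expand one affine argument at a time; \<open>vs\<close> collects the arguments already
  expanded.\<close>

lemma T_affine_polynomial:
  "k + length vs = n \<Longrightarrow> polynomial_in (\<lambda>t. T (replicate k (a + cscale t b) @ vs) $ i $ j)"
proof (induction k arbitrary: vs)
  case (Suc k)
  have "T (replicate (Suc k) (a + cscale t b) @ vs) $ i $ j = T (replicate k (a + cscale t b) @ a # vs) $ i $ j
      + t * T (replicate k (a + cscale t b) @ b # vs) $ i $ j" for t
    using Suc.prems T_add[of "replicate k (a + cscale t b)" vs a "cscale t b"]
      T_cscale[of "replicate k (a + cscale t b)" vs t b]
    by (simp flip: replicate_app_Cons_same)
  then show ?case
    using Suc.prems
    by (simp only:) (intro polynomial_in_add polynomial_in_mult polynomial_in_ident Suc.IH; simp)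
qed (simp add: polynomial_in_const)

text \<open>This is the derivative at t = 0: by symmetry each of the k affine slots contributes the
  same value. The induction turns constant slots into affine ones.\<close>

lemma T_affine_coeff:
  "k \<le> n \<Longrightarrow> \<exists>q. (\<forall>t. T (replicate k (a + cscale t b) @ replicate (n - k) a) $ i $ j = poly q t) \<and>
     coeff q 1 = of_nat k * T (b # replicate (n - 1) a) $ i $ j"
proof (induction k)
  case 0
  show ?case
    by (rule exI[of _ "[:T (replicate n a) $ i $ j:]"]) (simp add: coeff_pCons)
next
  case (Suc k)
  define m where "m = n - Suc k"
  have m: "n - k = Suc m" "k + Suc m = n"
    using Suc.prems by (auto simp: m_def)
  obtain q where q: "\<And>t. T (replicate k (a + cscale t b) @ replicate (n - k) a) $ i $ j = poly q t"
    "coeff q 1 = of_nat k * T (b # replicate (n - 1) a) $ i $ j"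
    using Suc by auto
  obtain q' where q': "\<And>t. T (replicate k (a + cscale t b) @ b # replicate m a) $ i $ j = poly q' t"
    using T_affine_polynomial[of k "b # replicate m a" a b i j] m by (auto simp: polynomial_in_def)
  have "coeff q' 0 = T (replicate k a @ b # replicate m a) $ i $ j"
    using q'[of 0] by (simp add: poly_0_coeff_0)
  also have "T (replicate k a @ b # replicate m a) = T (b # replicate (n - 1) a)"
  proof (rule T_perm)
    have "n - 1 = k + m" using m by simp
    then show "mset (replicate k a @ b # replicate m a) = mset (b # replicate (n - 1) a)"
      by (simp add: replicate_add)
  qed (use m in auto)
  finally have c0: "coeff q' 0 = T (b # replicate (n - 1) a) $ i $ j" .
  \<comment> \<open>The summand \<open>pCons 0 q'\<close> stands for t times q'(t), so it adds the
    constant coefficient of q' to the linear one.\<close>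
  have "T (replicate (Suc k) (a + cscale t b) @ replicate m a) $ i $ j = poly (q + pCons 0 q') t" for t
  proof -
    have "T (replicate (Suc k) (a + cscale t b) @ replicate m a) =
        T (replicate k (a + cscale t b) @ a # replicate m a) +
        cscale t (T (replicate k (a + cscale t b) @ b # replicate m a))"
      using m T_add[of "replicate k (a + cscale t b)" "replicate m a" a "cscale t b"]
        T_cscale[of "replicate k (a + cscale t b)" "replicate m a" t b]
      by (simp flip: replicate_app_Cons_same)
    then show ?thesis
      using q(1)[of t] q'[of t] m(1) by simp
  qed
  moreover have "coeff (q + pCons 0 q') 1 = of_nat (Suc k) * T (b # replicate (n - 1) a) $ i $ j"
    using q(2) c0 by (simp add: algebra_simps)
  ultimately show ?case
    unfolding m_def[symmetric] by blast
qed

end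

lemma bounded_homogeneous_polynomial_cscale:
  assumes "bounded_homogeneous_polynomial n P"
  shows "P (cscale c x) = cscale (c ^ n) (P x)"
proof -
  obtain T where T: "bounded_symmetric_multilinear n T" "\<And>x. P x = T (replicate n x)"
    using assms by (auto simp: bounded_homogeneous_polynomial_def)
  then interpret symmetric_multilinear n T
    by unfold_locales
  show ?thesis
    using T_replicate_cscale[of n "[]" c x] by (simp add: T)
qed

text \<open>The linear map is \<open>\<Phi>(x) = T(x, 1, \<dots>, 1)\<close>.  For a projection \<open>p\<close>, comparing the coefficients of
  \<open>t\<close> in \<open>P(1 + tp) = (1 + t)\<^sup>n P(p) + P(1 - p)\<close> gives \<open>\<Phi>(p) = P(p)\<close>.\<close>

theorem orthogonally_additive_polynomial:
  fixes P :: "'m::finite cmat \<Rightarrow> 's::finite cmat"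
  assumes hom: "bounded_homogeneous_polynomial n P" and "n > 0"
    and oa: "\<And>a b. self_adjoint a \<Longrightarrow> self_adjoint b \<Longrightarrow> a ** b = 0 \<Longrightarrow> P (a + b) = P a + P b"
  obtains \<Phi> where "complex_linear \<Phi>" "\<And>p. projection_matrix p \<Longrightarrow> \<Phi> p = P p"
    "\<And>x. P x = \<Phi> (mpow x n)"
proof -
  obtain T where T: "bounded_symmetric_multilinear n T" "\<And>x. P x = T (replicate n x)"
    using hom by (auto simp: bounded_homogeneous_polynomial_def)
  then interpret symmetric_multilinear n T
    by unfold_locales
  define \<Phi> where "\<Phi> x = T (x # replicate (n - 1) (mat 1))" for x
  have lin: "complex_linear \<Phi>"
    using T_add[of "[]" "replicate (n - 1) (mat 1)"] T_cscale[of "[]" "replicate (n - 1) (mat 1)"] \<open>n > 0\<close>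
    by (simp add: complex_linear_def \<Phi>_def)
  have \<Phi>P: "\<Phi> p = P p" if p: "projection_matrix p" for p
  proof -
    have "\<Phi> p $ i $ j = P p $ i $ j" for i j
    proof -
      obtain q where q: "\<And>t. T (replicate n (mat 1 + cscale t p)) $ i $ j = poly q t"
        "coeff q 1 = of_nat n * \<Phi> p $ i $ j"
        using T_affine_coeff[of n "mat 1" p i j] by (auto simp: \<Phi>_def)
      define q' where "q' = smult (P p $ i $ j) ([:1, 1:] ^ n) + [:P (mat 1 - p) $ i $ j:]"
      have "poly q (of_real t) = poly q' (of_real t)" for t
      proof -
        \<comment> \<open>For real t, 1 + tp is the sum of the orthogonal self-adjoint matrices (1 +
          t)p and 1 - p.\<close>
        define a where "a = cscale (of_real (1 + t)) p"
        note c = projection_matrix_complement[OF p]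
        have "P (a + (mat 1 - p)) = P a + P (mat 1 - p)"
          using p c self_adjoint_cscale_of_real[of p "1 + t"]
          by (intro oa) (simp_all add: a_def projection_matrix_def)
        moreover have "a + (mat 1 - p) = mat 1 + cscale (of_real t) p"
          by (simp add: a_def cmat_eq_iff algebra_simps)
        moreover have "P a = cscale ((1 + of_real t) ^ n) (P p)"
          unfolding a_def by (subst bounded_homogeneous_polynomial_cscale[OF hom]) simp
        ultimately have P: "P (mat 1 + cscale (of_real t) p) = cscale ((1 + of_real t) ^ n) (P p) + P (mat 1 - p)"
          by metis
        have "poly q (of_real t) = P (mat 1 + cscale (of_real t) p) $ i $ j"
          by (simp only: q(1) T(2))
        also have "\<dots> = poly q' (of_real t)"
          unfolding P by (simp add: q'_def mult.commute)
        finally show ?thesis .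
      qed
      then have "q = q'"
        by (rule poly_eq_of_real_eq)
      then have "of_nat n * \<Phi> p $ i $ j = of_nat n * P p $ i $ j"
        using q(2) coeff_linear_poly_power[of 1 n "1::complex" 1] \<open>n > 0\<close> by (simp add: q'_def mult.commute)
      then show ?thesis
        using \<open>n > 0\<close> by simp
    qed
    then show ?thesis by (simp add: cmat_eq_iff)
  qed
  have P0: "P 0 = 0"
    using oa[of 0 0] by (simp add: self_adjoint_iff)
  have sa: "P a = \<Phi> (mpow a n)" if a: "self_adjoint a" for a
  proof -
    obtain N p t where p: "orthogonal_projections N p" "(\<Sum>i<N. p i) = mat 1"
      and pow: "\<And>n. mpow a n = (\<Sum>i<N. cscale (of_real (t i ^ n)) (p i))"
      using spectral_decomposition[OF a] by metis
    have proj: "projection_matrix (p i)" if "i < N" for i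
      using orthogonal_projections_projection[OF p(1) that] .
    then have sap: "self_adjoint (cscale (of_real (t i)) (p i))" if "i < N" for i
      using that by (simp add: projection_matrix_def self_adjoint_cscale_of_real)
    have "P (\<Sum>i<k. cscale (of_real (t i)) (p i)) = (\<Sum>i<k. P (cscale (of_real (t i)) (p i)))" if "k \<le> N" for k
      using that
    proof (induction k)
      case (Suc k)
      have "(\<Sum>i<k. cscale (of_real (t i)) (p i)) ** cscale (of_real (t k)) (p k) = 0"
        using p(1) Suc.prems by (auto simp: orthogonal_projections_def matrix_sum_rdistrib intro!: sum.neutral)
      then have "P (\<Sum>i<Suc k. cscale (of_real (t i)) (p i))
          = P (\<Sum>i<k. cscale (of_real (t i)) (p i)) + P (cscale (of_real (t k)) (p k))"
        unfolding sum.lessThan_Suc using Suc.prems by (intro oa self_adjoint_sum sap) auto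
      then show ?case using Suc by simp
    qed (simp add: P0)
    then have "P a = (\<Sum>i<N. P (cscale (of_real (t i)) (p i)))"
      using pow[of 1] by simp
    also have "\<dots> = (\<Sum>i<N. cscale (of_real (t i ^ n)) (\<Phi> (p i)))"
      by (intro sum.cong) (auto simp: bounded_homogeneous_polynomial_cscale[OF hom] \<Phi>P proj)
    also have "\<dots> = \<Phi> (mpow a n)"
      by (simp add: pow complex_linear_sum[OF lin] complex_linear_cscale[OF lin])
    finally show ?thesis .
  qed
  have "P x = \<Phi> (mpow x n)" for x
  proof -
    obtain a b where ab: "self_adjoint a" "self_adjoint b" "x = a + cscale \<i> b"
      by (rule cartesian_decomposition)
    have mp: "polynomial_in (\<lambda>t. mpow (a + cscale t b) m $ i $ j)" for m i j
    proof (induction m arbitrary: i j)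
      case (Suc m)
      show ?case
        by (simp add: mult_nth) (intro polynomial_in_sum polynomial_in_mult polynomial_in_add
            polynomial_in_const polynomial_in_ident Suc)
    qed (simp add: polynomial_in_const)
    \<comment> \<open>Both sides are polynomials in t along a + tb and agree for real t, where a +
      tb is self-adjoint.\<close>
    have "P (a + cscale \<i> b) $ i $ j = \<Phi> (mpow (a + cscale \<i> b) n) $ i $ j" for i j
    proof (rule polynomial_in_eqI[of "\<lambda>t. P (a + cscale t b) $ i $ j" "\<lambda>t. \<Phi> (mpow (a + cscale t b) n) $ i $ j"])
      show "polynomial_in (\<lambda>t. P (a + cscale t b) $ i $ j)"
        using T_affine_polynomial[of n "[]" a b i j] by (simp add: T)
      show "polynomial_in (\<lambda>t. \<Phi> (mpow (a + cscale t b) n) $ i $ j)"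
        by (subst complex_linear_expansion[OF lin], simp)
          (intro polynomial_in_sum polynomial_in_mult polynomial_in_const mp)
      show "P (a + cscale (of_real t) b) $ i $ j = \<Phi> (mpow (a + cscale (of_real t) b) n) $ i $ j" for t
        using sa[of "a + cscale (of_real t) b"] ab by (simp add: self_adjoint_iff)
    qed
    then show ?thesis by (simp add: ab(3) cmat_eq_iff)
  qed
  with lin \<Phi>P show ?thesis by (rule that)
qed


section \<open>Power series expansion of the holomorphic map\<close>

lemma norm_vector_scalar_mult: "norm (c *s v) = norm (c::complex) * norm (v :: complex^'n)"
proof -
  have "norm (c *s v) = L2_set (\<lambda>i. norm c * norm (v $ i)) UNIV"
    by (simp add: norm_vec_def norm_mult)
  then show ?thesis
    by (simp add: norm_vec_def L2_set_right_distrib)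
qed

lemma op_norm_bound: "norm (A *v v) \<le> op_norm A * norm v"
  unfolding op_norm_def by (rule onorm) (rule matrix_vector_mul_bounded_linear)

lemma op_norm_nonneg: "op_norm A \<ge> 0"
  unfolding op_norm_def by (rule onorm_pos_le) (rule matrix_vector_mul_bounded_linear)

lemma op_norm_0: "op_norm 0 = 0"
  by (simp add: op_norm_def onorm_zero)

lemma op_norm_cscale_le: "op_norm (cscale c A) \<le> norm c * op_norm A"
proof -
  have "norm (cscale c A *v v) \<le> norm c * op_norm A * norm v" for v
  proof -
    have "cscale c A *v v = c *s (A *v v)"
      by (simp add: vec_eq_iff matrix_vector_mult_def sum_distrib_left mult.assoc)
    then show ?thesis
      using op_norm_bound[of A v] by (simp add: norm_vector_scalar_mult mult.assoc mult_left_mono)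
  qed
  then show ?thesis
    unfolding op_norm_def[of "cscale c A"] by (rule onorm_le)
qed

lemma op_ball_scaled:
  assumes "\<rho> > 0"
  obtains \<delta> where "\<delta> > 0" "\<And>z. norm z < \<delta> \<Longrightarrow> cscale z x \<in> op_ball 0 \<rho>"
proof
  have pos: "op_norm x + 1 > 0"
    using op_norm_nonneg[of x] by simp
  show "\<rho> / (op_norm x + 1) > 0"
    using assms pos by simp
  show "cscale z x \<in> op_ball 0 \<rho>" if "norm z < \<rho> / (op_norm x + 1)" for z
  proof -
    have "norm z * (op_norm x + 1) < \<rho>"
      using that pos by (simp add: pos_less_divide_eq)
    moreover have "norm z * op_norm x \<le> norm z * (op_norm x + 1)"
      by (intro mult_left_mono) auto
    ultimately show ?thesis
      using op_norm_cscale_le[of z x] by (simp add: op_ball_def)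
  qed
qed

lemma eventually_op_ball_scaled:
  assumes "\<rho> > 0"
  shows "eventually (\<lambda>z. cscale z x \<in> op_ball 0 \<rho>) (nhds 0)"
proof -
  obtain \<delta> where "\<delta> > 0" "\<And>z. norm z < \<delta> \<Longrightarrow> cscale z x \<in> op_ball 0 \<rho>"
    using op_ball_scaled[OF assms] by metis
  then show ?thesis
    by (auto simp: eventually_nhds_metric)
qed

section \<open>Uniqueness of power series coefficients\<close>

text \<open>Multiplying the series by \<open>z\<close> removes the restriction to positive degrees in
  \<open>powser_0_nonzero\<close>.\<close>

lemma power_series_unique:
  fixes c :: "nat \<Rightarrow> complex"
  assumes sums: "eventually (\<lambda>z. (\<lambda>n. c n * z ^ n) sums f z) (nhds 0)"
    and zero: "eventually (\<lambda>t::real. f (of_real t) = 0) (at_right 0)"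
  shows "c n = 0"
proof (rule ccontr)
  assume "c n \<noteq> 0"
  obtain \<epsilon> where "\<epsilon> > 0" and \<epsilon>: "\<And>z. norm z < \<epsilon> \<Longrightarrow> (\<lambda>n. c n * z ^ n) sums f z"
    using sums by (auto simp: eventually_nhds_metric)
  define d where "d n = (case n of 0 \<Rightarrow> 0 | Suc k \<Rightarrow> c k)" for n
  have d: "(\<lambda>n. d n * (z - 0) ^ n) sums (z * f z)" if "norm (z - 0) < \<epsilon>" for z
  proof -
    have "(\<lambda>n. z * (c n * z ^ n)) sums (z * f z)"
      using \<epsilon>[of z] that by (intro sums_mult) simp
    then have "(\<lambda>n. d (Suc n) * z ^ Suc n) sums (z * f z)"
      by (simp add: d_def ac_simps)
    then show ?thesis
      by (subst (asm) sums_Suc_iff) (simp add: d_def)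
  qed
  \<comment> \<open>A series with a non-zero coefficient has no zeros in some punctured disc,
    contrary to the vanishing at small positive reals.\<close>
  obtain s where "s > 0" and s: "\<And>z. z \<in> cball 0 s - {0} \<Longrightarrow> z * f z \<noteq> 0"
    using powser_0_nonzero[of \<epsilon> 0 d "\<lambda>z. z * f z" "Suc n"] \<open>\<epsilon> > 0\<close> d \<open>c n \<noteq> 0\<close>
    by (auto simp: d_def)
  obtain b where "b > 0" and b: "\<And>t::real. 0 < t \<Longrightarrow> t < b \<Longrightarrow> f (of_real t) = 0"
    using zero by (auto simp: eventually_at_right_field)
  define t where "t = min s (b/2)"
  have "t > 0" "t \<le> s" "t < b"
    using \<open>s > 0\<close> \<open>b > 0\<close> by (auto simp: t_def)
  then show False
    using s[of "of_real t"] b[of t] by simp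
qed

lemma sums_cmat_nth: "f sums A \<Longrightarrow> (\<lambda>n. f n $ i $ j) sums (A $ i $ j)"
  by (intro sums_vec_nth)

lemma sums_cmatI:
  fixes A :: "complex^'n^'m"
  assumes "\<And>i j. (\<lambda>n. f n $ i $ j) sums (A $ i $ j)"
  shows "f sums A"
  unfolding sums_def
  by (intro vec_tendstoI) (use assms in \<open>simp add: sums_def\<close>)

text \<open>Vanishing is asked only for small positive real arguments, because the orthogonality
  hypotheses speak only of self-adjoint matrices.\<close>

lemma matrix_power_series_unique:
  assumes sums: "eventually (\<lambda>z. (\<lambda>n. cscale (z ^ n) (C n)) sums F z) (nhds 0)"
    and zero: "eventually (\<lambda>t::real. F (of_real t) = 0) (at_right 0)"
  shows "C n = 0"
proof -
  have "C n $ i $ j = 0" for i j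
  proof (rule power_series_unique[of "\<lambda>n. C n $ i $ j" "\<lambda>z. F z $ i $ j"])
    show "eventually (\<lambda>z. (\<lambda>n. C n $ i $ j * z ^ n) sums F z $ i $ j) (nhds 0)"
      using sums by eventually_elim (auto dest: sums_cmat_nth simp: mult.commute)
    show "eventually (\<lambda>t::real. F (of_real t) $ i $ j = 0) (at_right 0)"
      using zero by eventually_elim simp
  qed
  then show ?thesis by (simp add: cmat_eq_iff)
qed

lemma bounded_linear_matrix_mult:
  "bounded_linear (\<lambda>X. A ** X ** B)" for A :: "complex^'n^'m" and B :: "complex^'q^'p"
  unfolding linear_conv_bounded_linear[symmetric]
  by (rule linearI)
    (simp_all add: matrix_add_ldistrib matrix_add_rdistrib matrix_scalar_ac flip: scalar_matrix_assoc)

lemma sums_matrix_mult: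
  fixes A :: "complex^'n^'m" and B :: "complex^'q^'p"
  assumes "f sums X"
  shows "(\<lambda>n. A ** f n ** B) sums (A ** X ** B)"
  using bounded_linear.sums[OF bounded_linear_matrix_mult assms] .

lemma eventually_of_real_at_right:
  assumes "eventually Q (nhds (0::complex))"
  shows "eventually (\<lambda>t::real. Q (of_real t)) (at_right 0)"
proof -
  obtain e where "e > 0" "\<And>z. norm z < e \<Longrightarrow> Q z"
    using assms by (auto simp: eventually_nhds_metric)
  then show ?thesis
    by (auto simp: eventually_at_right_field intro!: exI[of _ e])
qed

section \<open>Taylor expansion on the whole ball\<close>

lemma mat_holomorphic_on_expansion:
  assumes "mat_holomorphic_on H U" "a \<in> U"
  obtains \<rho> P where "\<rho> > 0" "op_ball a \<rho> \<subseteq> U" "\<And>n. bounded_homogeneous_polynomial n (P n)"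
    "\<And>x. x \<in> op_ball a \<rho> \<Longrightarrow> (\<lambda>n. P n (x - a)) sums H x"
proof -
  obtain \<rho> P where \<rho>: "\<rho> > 0" "op_ball a \<rho> \<subseteq> U" "\<And>n. bounded_homogeneous_polynomial n (P n)"
    and lim: "uniform_limit (op_ball a \<rho>) (\<lambda>N x. \<Sum>n<N. P n (x - a)) H sequentially"
    using assms unfolding mat_holomorphic_on_def by metis
  have "(\<lambda>n. P n (x - a)) sums H x" if "x \<in> op_ball a \<rho>" for x
    using tendsto_uniform_limitI[OF lim that] by (simp add: sums_def)
  with \<rho> show ?thesis by (rule that)
qed

lemma eventually_expansion_on_line:
  assumes "\<rho> > 0" and P: "\<And>n. bounded_homogeneous_polynomial n (P n)"
    and sums: "\<And>x. x \<in> op_ball a \<rho> \<Longrightarrow> (\<lambda>n. P n (x - a)) sums H x"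
  shows "eventually (\<lambda>z. (\<lambda>n. cscale (z ^ n) (P n x)) sums H (a + cscale z x)) (nhds 0)"
  using eventually_op_ball_scaled[OF \<open>\<rho> > 0\<close>, of x]
proof eventually_elim
  case (elim z)
  then have "a + cscale z x \<in> op_ball a \<rho>"
    by (simp add: op_ball_def)
  from sums[OF this] show ?case
    by (simp add: bounded_homogeneous_polynomial_cscale[OF P])
qed

text \<open>The expansion of H at the point \<open>cscale w x\<close> restricts on the line to a
  power series in z - w.\<close>

lemma mat_holomorphic_on_line:
  assumes H: "mat_holomorphic_on H U" and line: "\<And>z. z \<in> ball 0 R \<Longrightarrow> cscale z x \<in> U"
  shows "(\<lambda>z. H (cscale z x) $ i $ j) holomorphic_on ball 0 R"
proof -
  have "(\<lambda>z. H (cscale z x) $ i $ j) field_differentiable at w" if w: "w \<in> ball 0 R" for w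
  proof -
    obtain \<rho> P where \<rho>: "\<rho> > 0" and P: "\<And>n. bounded_homogeneous_polynomial n (P n)"
      and sums: "\<And>y. y \<in> op_ball (cscale w x) \<rho> \<Longrightarrow> (\<lambda>n. P n (y - cscale w x)) sums H y"
      using mat_holomorphic_on_expansion[OF H line[OF w]] by metis
    obtain \<delta> where "\<delta> > 0"
      and \<delta>: "\<And>z. norm z < \<delta> \<Longrightarrow> (\<lambda>n. cscale (z ^ n) (P n x)) sums H (cscale w x + cscale z x)"
      using eventually_expansion_on_line[of \<rho> P "cscale w x" H x] \<rho> P sums
      by (auto simp: eventually_nhds_metric)
    have "(\<lambda>n. P n x $ i $ j * (z - w) ^ n) sums (H (cscale z x) $ i $ j)" if "z \<in> ball w \<delta>" for z
    proof -
      have "cscale w x + cscale (z - w) x = cscale z x"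
        by (simp add: cmat_eq_iff algebra_simps)
      then show ?thesis
        using sums_cmat_nth[OF \<delta>[of "z - w"], of i j] that
        by (simp add: dist_norm norm_minus_commute mult.commute)
    qed
    then have "(\<lambda>z. H (cscale z x) $ i $ j) holomorphic_on ball w \<delta>"
      by (rule power_series_holomorphic)
    then show ?thesis
      using \<open>\<delta> > 0\<close> by (simp add: holomorphic_on_imp_differentiable_at)
  qed
  then show ?thesis
    by (auto simp: holomorphic_on_def intro: field_differentiable_at_within)
qed

text \<open>Holomorphy at 0 gives the expansion only on some small ball. On the complex line through
  x, however, H is holomorphic on a disc of radius greater than 1. Its Taylor coefficients there are
  the \<open>P n x\<close>, and z = 1 gives the claim.\<close>

lemma mat_holomorphic_on_op_ball_expansion:
  assumes "r > 0" and H: "mat_holomorphic_on H (op_ball 0 r)"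
  obtains P where "\<And>n. bounded_homogeneous_polynomial n (P n)"
    "\<And>x. x \<in> op_ball 0 r \<Longrightarrow> (\<lambda>n. P n x) sums H x"
proof -
  have "0 \<in> op_ball 0 r"
    using \<open>r > 0\<close> by (simp add: op_ball_def op_norm_0)
  then obtain \<rho> P where \<rho>: "\<rho> > 0" and P: "\<And>n. bounded_homogeneous_polynomial n (P n)"
    and sums: "\<And>y. y \<in> op_ball 0 \<rho> \<Longrightarrow> (\<lambda>n. P n (y - 0)) sums H y"
    using mat_holomorphic_on_expansion[OF H] by metis
  have "(\<lambda>n. P n x) sums H x" if x: "x \<in> op_ball 0 r" for x
  proof (rule sums_cmatI)
    fix i j
    \<comment> \<open>For non-zero x this is the harmonic mean of 1 and the ratio of r to the norm
      of x, hence strictly between them; the formula also covers x = 0.\<close>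
    define R where "R = 2 * r / (r + op_norm x)"
    have o: "0 \<le> op_norm x" "op_norm x < r"
      using x op_norm_nonneg by (auto simp: op_ball_def)
    then have "R > 1"
      by (simp add: R_def field_simps)
    have "cscale z x \<in> op_ball 0 r" if "z \<in> ball 0 R" for z
    proof -
      have "norm z * op_norm x \<le> R * op_norm x"
        using that o by (intro mult_right_mono) auto
      also have "\<dots> < r"
      proof -
        have "r * (2 * op_norm x) < r * (r + op_norm x)"
          using o \<open>r > 0\<close> by (intro mult_strict_left_mono) auto
        then show ?thesis
          using o \<open>r > 0\<close> by (simp add: R_def pos_divide_less_eq algebra_simps)
      qed
      finally show ?thesis
        using op_norm_cscale_le[of z x] by (simp add: op_ball_def)
    qed
    then have hol: "(\<lambda>z. H (cscale z x) $ i $ j) holomorphic_on ball 0 R" (is "?f holomorphic_on _")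
      by (rule mat_holomorphic_on_line[OF H])
    define c where "c n = (deriv ^^ n) ?f 0 / fact n" for n
    have c: "(\<lambda>n. c n * z ^ n) sums ?f z" if "z \<in> ball 0 R" for z
      using holomorphic_power_series[OF hol that] by (simp add: c_def)
    have "eventually (\<lambda>z. z \<in> ball 0 R) (nhds (0::complex))"
      using \<open>R > 1\<close> by (intro eventually_nhds_in_open) auto
    moreover have "eventually (\<lambda>z. (\<lambda>n. cscale (z ^ n) (P n x)) sums H (cscale z x)) (nhds 0)"
      using eventually_expansion_on_line[of \<rho> P 0 H x] \<rho> P sums by simp
    ultimately have "eventually (\<lambda>z. (\<lambda>n. (P n x $ i $ j - c n) * z ^ n) sums 0) (nhds 0)"
    proof eventually_elim
      case (elim z)
      then have "(\<lambda>n. P n x $ i $ j * z ^ n) sums ?f z"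
        using sums_cmat_nth[of "\<lambda>n. cscale (z ^ n) (P n x)" _ i j] by (simp add: mult.commute)
      from sums_diff[OF this c[OF elim(1)]] show ?case
        by (simp add: algebra_simps)
    qed
    then have "P n x $ i $ j - c n = 0" for n
      by (rule power_series_unique[of "\<lambda>n. P n x $ i $ j - c n" "\<lambda>_. 0"]) simp
    then show "(\<lambda>n. P n x $ i $ j) sums H x $ i $ j"
      using c[of 1] \<open>R > 1\<close> by simp
  qed
  with P show ?thesis by (rule that)
qed

text \<open>Along positive real multiples of a and b the hypotheses on H become identities of power
  series, which uniqueness of coefficients passes on to every \<open>P n\<close>. For products this
  is done twice, first in the multiple of b and then in that of a.\<close>

theorem orthogonal_holomorphic_expansion:
  fixes H :: "'m::finite cmat \<Rightarrow> 's::finite cmat"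
  assumes "r > 0" and H: "mat_holomorphic_on H (op_ball 0 r)"
    and oa: "orthogonally_additive_sa (op_ball 0 r) H"
    and om: "orthogonally_multiplicative_sa (op_ball 0 r) H"
  obtains \<Phi> where "projection_orthogonality_preserving \<Phi>"
    "\<And>x. x \<in> op_ball 0 r \<Longrightarrow> (\<lambda>n. \<Phi> (Suc n) (mpow x (Suc n))) sums H x"
proof -
  obtain P where P: "\<And>n. bounded_homogeneous_polynomial n (P n)"
    and sums: "\<And>x. x \<in> op_ball 0 r \<Longrightarrow> (\<lambda>n. P n x) sums H x"
    using mat_holomorphic_on_op_ball_expansion[OF \<open>r > 0\<close> H] by metis
  have line: "eventually (\<lambda>z. (\<lambda>n. cscale (z ^ n) (P n x)) sums H (cscale z x)) (nhds 0)" for x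
    using eventually_expansion_on_line[OF \<open>r > 0\<close> P, where a = 0 and H = H] sums by simp
  have ball: "eventually (\<lambda>t::real. cscale (of_real t) x \<in> op_ball 0 r) (at_right 0)" for x :: "'m cmat"
    by (rule eventually_of_real_at_right) (rule eventually_op_ball_scaled[OF \<open>r > 0\<close>])
  have Padd: "P n (a + b) = P n a + P n b"
    if ab: "self_adjoint a" "self_adjoint b" "a ** b = 0" for n a b
  proof -
    define F where "F z = H (cscale z (a + b)) - (H (cscale z a) + H (cscale z b))" for z
    have "P n (a + b) - (P n a + P n b) = 0"
    proof (rule matrix_power_series_unique[of "\<lambda>n. P n (a + b) - (P n a + P n b)" F])
      show "eventually (\<lambda>z. (\<lambda>n. cscale (z ^ n) (P n (a + b) - (P n a + P n b))) sums F z) (nhds 0)"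
        using line[of "a + b"] line[of a] line[of b]
        by eventually_elim (simp add: F_def cscale_diff_right cscale_add_right sums_diff sums_add)
      show "eventually (\<lambda>t::real. F (of_real t) = 0) (at_right 0)"
        using ball[of a] ball[of b]
      proof eventually_elim
        case (elim t)
        then show ?case
          using oa ab
          by (simp add: F_def orthogonally_additive_sa_def cscale_add_right self_adjoint_cscale_of_real)
      qed
    qed
    then show ?thesis by simp
  qed
  have Pmult: "P n a ** P k b = 0"
    if ab: "self_adjoint a" "self_adjoint b" "a ** b = 0" for n k a b
  proof -
    have step: "H (cscale (of_real s) a) ** P k b = 0" if s: "cscale (of_real s) a \<in> op_ball 0 r" for s :: real
    proof (rule matrix_power_series_unique[of "\<lambda>k. H (cscale (of_real s) a) ** P k b"
          "\<lambda>z. H (cscale (of_real s) a) ** H (cscale z b)"])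
      show "eventually (\<lambda>z. (\<lambda>k. cscale (z ^ k) (H (cscale (of_real s) a) ** P k b)) sums
          (H (cscale (of_real s) a) ** H (cscale z b))) (nhds 0)"
        using line[of b]
      proof eventually_elim
        case (elim z)
        from sums_matrix_mult[OF this, of "H (cscale (of_real s) a)" "mat 1"] show ?case
          by simp
      qed
      show "eventually (\<lambda>t::real. H (cscale (of_real s) a) ** H (cscale (of_real t) b) = 0) (at_right 0)"
        using ball[of b]
      proof eventually_elim
        case (elim t)
        then show ?case
          using om ab s by (simp add: orthogonally_multiplicative_sa_def self_adjoint_cscale_of_real)
      qed
    qed
    show ?thesis
    proof (rule matrix_power_series_unique[of "\<lambda>n. P n a ** P k b" "\<lambda>z. H (cscale z a) ** P k b"])
      show "eventually (\<lambda>z. (\<lambda>n. cscale (z ^ n) (P n a ** P k b)) sums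
          (H (cscale z a) ** P k b)) (nhds 0)"
        using line[of a]
      proof eventually_elim
        case (elim z)
        from sums_matrix_mult[OF this, of "mat 1" "P k b"] show ?case
          by simp
      qed
      show "eventually (\<lambda>t::real. H (cscale (of_real t) a) ** P k b = 0) (at_right 0)"
        using ball[of a] by eventually_elim (rule step)
    qed
  qed
  \<comment> \<open>Additivity at 0 kills the constant term, so the series starts in degree
    1.\<close>
  have "P 0 0 = 0"
    using Padd[of 0 0 0] by (simp add: self_adjoint_iff)
  then have P0: "P 0 x = 0" for x
    using bounded_homogeneous_polynomial_cscale[OF P, of 0 0 x] by simp
  have "\<exists>\<phi>. complex_linear \<phi> \<and> (\<forall>p. projection_matrix p \<longrightarrow> \<phi> p = P n p) \<and> (\<forall>x. P n x = \<phi> (mpow x n))" for n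
  proof (cases "n = 0")
    case True
    then show ?thesis
      by (intro exI[of _ "\<lambda>_. 0"]) (simp add: complex_linear_def P0)
  next
    case False
    then have "n > 0"
      by simp
    then show ?thesis
      by (rule orthogonally_additive_polynomial[OF P[of n]]) (rule Padd, assumption+, blast)
  qed
  then obtain \<Phi> where lin: "\<And>n. complex_linear (\<Phi> n)"
    and proj: "\<And>n p. projection_matrix p \<Longrightarrow> \<Phi> n p = P n p"
    and pow: "\<And>n x. P n x = \<Phi> n (mpow x n)"
    by metis
  have "projection_orthogonality_preserving \<Phi>"
  proof
    show "\<Phi> j p ** \<Phi> k q = 0" if "projection_matrix p" "projection_matrix q" "p ** q = 0" for p q j k
      using Pmult[of p q j k] that proj by (simp add: projection_matrix_def)
  qed (rule lin)
  moreover have "(\<lambda>n. \<Phi> (Suc n) (mpow x (Suc n))) sums H x" if "x \<in> op_ball 0 r" for x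
  proof -
    have "(\<lambda>n. P (Suc n) x) sums H x"
      using sums[OF that] by (subst sums_Suc_iff) (simp add: P0)
    then show ?thesis
      by (simp only: pow)
  qed
  ultimately show ?thesis by (rule that)
qed

section \<open>Zero products exclude the transpose\<close>

text \<open>With \<open>a = E\<^sub>i\<^sub>i\<close> and \<open>b = E\<^sub>j\<^sub>j + E\<^sub>j\<^sub>i\<close> one has \<open>ab = 0\<close>, while the product of the transposes is
  \<open>E\<^sub>i\<^sub>j\<close>.  Both are idempotent, so \<open>H(za)\<close> and \<open>H(zb)\<close> involve the same scalar series.\<close>

lemma transposed_series_vanishes:
  fixes H :: "'m::finite cmat \<Rightarrow> 's::finite cmat" and S :: "complex^'s^'m"
  assumes "CARD('m) \<ge> 2" and "r > 0" and S: "invertible S"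
    and sums: "\<And>x. x \<in> op_ball 0 r \<Longrightarrow> conj_series lam S (transpose x) sums H x"
    and pres: "preserves_zero_products (op_ball 0 r) H"
  shows "lam (Suc n) = 0"
proof -
  let ?T = "matrix_inv S"
  note ST = invertible_matrix_inv[OF S]
  have "\<exists>i j :: 'm. i \<noteq> j"
  proof (rule ccontr)
    assume "\<not> ?thesis"
    then have "(UNIV :: 'm set) = {undefined}"
      by blast
    then have "CARD('m) = 1"
      by (metis card_1_singleton_iff One_nat_def)
    with assms(1) show False by simp
  qed
  then obtain i j :: 'm where ij: "i \<noteq> j"
    by blast
  define a b where "a = matrix_unit i i" and "b = matrix_unit j j + matrix_unit j i"
  have tr: "transpose (matrix_unit k l) = matrix_unit l k" for k l :: 'm
    by (auto simp: cmat_eq_iff transpose_def matrix_unit_nth)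
  have tb: "transpose b = matrix_unit j j + matrix_unit i j" and ta: "transpose a = a"
    by (auto simp: a_def b_def cmat_eq_iff transpose_def matrix_unit_nth)
  have ab: "a ** b = 0" and aa: "a ** a = a" and bb: "transpose b ** transpose b = transpose b"
    and atb: "transpose a ** transpose b = matrix_unit i j"
    using ij by (simp_all add: a_def b_def tb[unfolded b_def] ta[unfolded a_def] matrix_add_ldistrib
        matrix_add_rdistrib matrix_unit_mult)
  have idem: "mpow e (Suc k) = e" if "e ** e = e" for e :: "'m cmat" and k
    by (induction k) (simp_all add: that)
  have series: "(\<lambda>n. cscale (lam (Suc n) * z ^ Suc n) (?T ** transpose e ** S)) sums H (cscale z e)"
    if "transpose e ** transpose e = transpose e" "cscale z e \<in> op_ball 0 r" for e z
  proof -
    have "transpose (cscale z e) = cscale z (transpose e)"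
      by (simp add: cmat_eq_iff transpose_def)
    moreover have "?T ** cscale c X ** S = cscale c (?T ** X ** S)" for c X
      by (simp add: cmat_eq_iff mult_nth sum_distrib_left sum_distrib_right ac_simps)
    ultimately show ?thesis
      using sums[OF that(2)]
      by (simp add: conj_series_def mpow_cscale idem[OF that(1)] del: mpow.simps power_Suc)
  qed
  \<comment> \<open>Undoing the conjugation, the (i, i) entry recovers the scalar series of
    \<open>lam n * z ^ n\<close> over n >= 1.\<close>
  define g where "g z = (S ** H (cscale z a) ** ?T) $ i $ i" for z
  have g: "(\<lambda>n. lam (Suc n) * z ^ Suc n) sums g z" if "cscale z a \<in> op_ball 0 r" for z
  proof -
    have "(S ** cscale c (?T ** transpose a ** S) ** ?T) $ i $ i = c" for c
    proof -
      have "S ** cscale c (?T ** transpose a ** S) ** ?T = cscale c (S ** (?T ** transpose a ** S) ** ?T)"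
        by (simp add: cmat_eq_iff mult_nth sum_distrib_left sum_distrib_right ac_simps)
      also have "S ** (?T ** transpose a ** S) ** ?T = transpose a"
        by (metis ST(1) matrix_mul_assoc matrix_mul_lid matrix_mul_rid)
      finally show ?thesis
        by (simp add: ta) (simp add: a_def matrix_unit_nth)
    qed
    then show ?thesis
      using sums_cmat_nth[OF sums_matrix_mult[OF series[of a z], of S ?T], of i i] that aa ta
      by (simp add: g_def)
  qed
  have H: "H (cscale z e) = cscale (g z) (?T ** transpose e ** S)"
    if "transpose e ** transpose e = transpose e" "cscale z e \<in> op_ball 0 r" "cscale z a \<in> op_ball 0 r" for e z
  proof -
    have "(\<lambda>n. cscale (lam (Suc n) * z ^ Suc n) A) sums cscale (g z) A" for A :: "'s cmat"
      by (intro sums_cmatI) (simp add: sums_mult2[OF g[OF that(3)]] del: power_Suc)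
    then show ?thesis
      using series[OF that(1,2)] sums_unique2 by blast
  qed
  have g0: "g (of_real t) = 0" if t: "cscale (of_real t) a \<in> op_ball 0 r" "cscale (of_real t) b \<in> op_ball 0 r" for t
  proof -
    have "H (cscale (of_real t) a) ** H (cscale (of_real t) b) = 0"
      using pres t ab by (simp add: preserves_zero_products_def)
    then have "cscale (g (of_real t) * g (of_real t)) (?T ** transpose a ** S ** (?T ** transpose b ** S)) = 0"
      using H[of a "of_real t"] H[of b "of_real t"] t aa bb ta by simp
    moreover have "?T ** transpose a ** S ** (?T ** transpose b ** S) = ?T ** matrix_unit i j ** S"
      by (metis ST(1) atb matrix_mul_assoc matrix_mul_rid)
    moreover have "?T ** matrix_unit i j ** S \<noteq> 0"
    proof
      assume "?T ** matrix_unit i j ** S = 0"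
      then have "S ** (?T ** matrix_unit i j ** S) ** ?T = 0"
        by simp
      moreover have "S ** (?T ** matrix_unit i j ** S) ** ?T = matrix_unit i j"
        by (metis ST(1) matrix_mul_assoc matrix_mul_lid matrix_mul_rid)
      ultimately have "matrix_unit i j $ i $ j = 0"
        by simp
      then show False
        by (simp add: matrix_unit_nth)
    qed
    ultimately show ?thesis by simp
  qed
  \<comment> \<open>The series \<open>g\<close> starts in degree 1, so the value of
    \<open>lam\<close> at 0 is replaced by 0.\<close>
  define c where "c n = (if n = 0 then 0 else lam n)" for n
  have "c (Suc n) = 0"
  proof (rule power_series_unique[of c g])
    show "eventually (\<lambda>z. (\<lambda>n. c n * z ^ n) sums g z) (nhds 0)"
      using eventually_op_ball_scaled[OF \<open>r > 0\<close>, of a]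
    proof eventually_elim
      case (elim z)
      then have "(\<lambda>n. c (Suc n) * z ^ Suc n) sums g z"
        using g by (simp add: c_def)
      then show ?case
        by (subst (asm) sums_Suc_iff) (simp add: c_def)
    qed
    show "eventually (\<lambda>t::real. g (of_real t) = 0) (at_right 0)"
      using eventually_of_real_at_right[OF eventually_op_ball_scaled[OF \<open>r > 0\<close>, of a]]
        eventually_of_real_at_right[OF eventually_op_ball_scaled[OF \<open>r > 0\<close>, of b]]
      by eventually_elim (rule g0)
  qed
  then show ?thesis
    by (simp add: c_def)
qed


section \<open>Classification by traces of the linearised Taylor coefficients\<close>

theorem theorem1p3:
  fixes H :: "complex^'m^'m \<Rightarrow> complex^'s^'s" and r :: real
  assumes "CARD('m) \<ge> 2" and "CARD('m) \<ge> CARD('s)" and "r > 0"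
    and "mat_holomorphic_on H (op_ball 0 r)"
    and "orthogonally_additive_sa (op_ball 0 r) H"
    and "orthogonally_multiplicative_sa (op_ball 0 r) H"
  defines "caseA \<equiv> \<forall>x\<in>op_ball 0 r. trace (H x) = 0"
    and "ddagger \<equiv> \<lambda>(lam :: nat \<Rightarrow> complex) (S :: complex^'s^'m).
           \<forall>x\<in>op_ball 0 r. conj_series lam S x sums H x"
    and "ddagger_t \<equiv> \<lambda>(lam :: nat \<Rightarrow> complex) (S :: complex^'s^'m).
           \<forall>x\<in>op_ball 0 r. conj_series lam S (transpose x) sums H x"
  defines "caseB \<equiv> CARD('s) = CARD('m) \<and>
           (\<exists>lam S. invertible S \<and> (ddagger lam S \<or> ddagger_t lam S))"
  shows "(caseA \<or> caseB) \<and>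
         (CARD('s) < CARD('m) \<longrightarrow> caseA) \<and>
         (caseB \<and> preserves_zero_products (op_ball 0 r) H \<longrightarrow>
            (\<exists>lam S. invertible S \<and> ddagger lam S))"
proof -
  obtain \<Phi> where \<Phi>: "projection_orthogonality_preserving \<Phi>"
    and sums: "\<And>x. x \<in> op_ball 0 r \<Longrightarrow> (\<lambda>n. \<Phi> (Suc n) (mpow x (Suc n))) sums H x"
    by (rule orthogonal_holomorphic_expansion[OF assms(3-6)]) blast
  interpret projection_orthogonality_preserving \<Phi>
    by (rule \<Phi>)
  \<comment> \<open>The cases are split by whether every value of every \<open>\<Phi> k\<close> has
    trace zero; the trace is taken termwise in the series.\<close>
  have A: caseA if "\<And>k x. trace (\<Phi> k x) = 0"
    unfolding caseA_def
  proof
    fix x :: "'m cmat"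
    assume "x \<in> op_ball 0 r"
    from sums[OF this] have "(\<lambda>n. \<Sum>i\<in>UNIV. \<Phi> (Suc n) (mpow x (Suc n)) $ i $ i) sums (\<Sum>i\<in>UNIV. H x $ i $ i)"
      by (intro sums_sum sums_cmat_nth)
    then have "(\<lambda>n. trace (\<Phi> (Suc n) (mpow x (Suc n)))) sums trace (H x)"
      by (simp only: trace_def)
    then show "trace (H x) = 0"
      using that sums_unique2[OF sums_zero] by simp
  qed
  have B: caseB if nz: "trace (\<Phi> k x) \<noteq> 0" for k x
  proof -
    obtain lam and S :: "complex^'s^'m" where S: "invertible S"
      and form: "(\<forall>k x. \<Phi> k x = cscale (lam k) (matrix_inv S ** x ** S)) \<or>
        (\<forall>k x. \<Phi> k x = cscale (lam k) (matrix_inv S ** transpose x ** S))"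
      by (rule conjugation_form[OF nz assms(2)])
    from form have "ddagger lam S \<or> ddagger_t lam S"
    proof
      assume "\<forall>k x. \<Phi> k x = cscale (lam k) (matrix_inv S ** x ** S)"
      then show ?thesis
        using sums by (simp add: ddagger_def conj_series_def del: mpow.simps)
    next
      assume "\<forall>k x. \<Phi> k x = cscale (lam k) (matrix_inv S ** transpose x ** S)"
      then show ?thesis
        using sums by (simp add: ddagger_t_def conj_series_def transpose_mpow del: mpow.simps)
    qed
    then show ?thesis
      using S card_le[OF nz] assms(2) unfolding caseB_def
      by (intro conjI exI[of _ lam] exI[of _ S]) auto
  qed
  have small: caseA if "CARD('s) < CARD('m)"
    by (rule A) (use card_le that in fastforce)
  have "\<exists>lam S. invertible S \<and> ddagger lam S" if B: caseB and pres: "preserves_zero_products (op_ball 0 r) H"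
  proof -
    obtain lam S where S: "invertible S" "ddagger lam S \<or> ddagger_t lam S"
      using B unfolding caseB_def by blast
    have "ddagger lam S" if t: "ddagger_t lam S"
    proof -
      \<comment> \<open>All coefficients that occur vanish, so the same \<open>lam\<close> and S
        also satisfy the untransposed form.\<close>
      have "lam (Suc n) = 0" for n
        using transposed_series_vanishes[OF assms(1,3) S(1) _ pres] t
        by (simp add: ddagger_t_def)
      then have "conj_series lam S x = conj_series lam S (transpose x)" for x
        by (simp add: conj_series_def fun_eq_iff)
      then show ?thesis
        using t by (simp add: ddagger_def ddagger_t_def)
    qed
    then show ?thesis using S by blast
  qed
  then show ?thesis
    using A B small by blast
qed

end
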